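(* Let $\mathcal C$ be a triangulated category and let $(\mathcal D,\mathcal T)$ be a right filterable pair of $t$-structures of type $(n,0)$ on $\mathcal C$, with right basic hearts $\mathcal H_\ell$ and right basic torsion pairs $(\mathcal X_\ell,\mathcal Y_\ell)$ in $\mathcal H_\ell$. For any object $X$ in $\mathcal H_{\mathcal D}$ one can functorially construct a finite binary tree (the right $t$-tree of $X$) with root $X$ and with vertices $X_{i_1\dots i_\ell}$ for $0\le \ell\le n$ and $i_1,\dots,i_\ell\in\{0,1\}$ (the vertex with empty index being $X$ itself; thus each branch has $n+1$ vertices and the vertex $X_{i_1\dots i_\ell}$, $\ell<n$, has the two children $X_{i_1\dots i_\ell 0}$ and $X_{i_1\dots i_\ell 1}$), such that for each $\ell=0,\dots,n-1$ and all $i_1,\dots,i_\ell\in\{0,1\}$ there is a short exact sequence $$0\to X_{i_1\dots i_\ell 0}\to X_{i_1\dots i_\ell}\to X_{i_1\dots i_\ell 1}\to 0$$ in the shifted right basic heart $\mathcal H_\ell[-(i_1+\cdots+i_\ell)]$, with $X_{i_1\dots i_\ell 0}$ belonging to the torsion class $\mathcal X_\ell[-(i_1+\cdots+i_\ell)]$ and $X_{i_1\dots i_\ell 1}$ belonging to the torsion-free class $\mathcal Y_\ell[-(i_1+\cdots+i_\ell)]$.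
   Context: Full subcategories are closed under isomorphisms and additive. For a $t$-structure $\mathcal D=(\mathcal D^{\le 0},\mathcal D^{\ge 0})$ on $\mathcal C$ put $\mathcal D^{\le i}:=\mathcal D^{\le 0}[-i]$, $\mathcal D^{\ge i}:=\mathcal D^{\ge 0}[-i]$; $\mathcal D^{\le 0}$ is the aisle, $\mathcal D^{\ge 0}$ the co-aisle, $\mathcal H_{\mathcal D}=\mathcal D^{\le 0}\cap\mathcal D^{\ge 0}$ the heart. All $t$-structures considered are non-degenerate: $\bigcap_i\mathcal D^{\le i}=0=\bigcap_i\mathcal D^{\ge i}$. A $t$-structure is determined by its co-aisle. $(\mathcal D,\mathcal T)$ is of type $(n,k)$ if $k\in\mathbb Z$ is maximal with $\mathcal T^{\le k}\subseteq\mathcal D^{\le 0}$ and $n\in\mathbb N$ is minimal with $\mathcal D^{\le -n}\subseteq\mathcal T^{\le k}$. $(\mathcal D,\mathcal T)$ is right filterable if for every $i\in\mathbb Z$ the intersection $\mathcal D^{\ge i}\cap\mathcal T^{\ge 0}$ is the co-aisle of a $t$-structure. In this case the right basic $t$-structure $\mathcal D_i$ ($i\in\mathbb Z$) is the $t$-structure with co-aisle $\mathcal D_i^{\ge 0}=\mathcal D^{\ge -i}\cap\mathcal T^{\ge 0}$; the right basic heart $\mathcal H_i$ is its heart; and the right basic torsion pair is $(\mathcal X_i,\mathcal Y_i)$ with $\mathcal X_i:=\mathcal D_{i+1}^{\le 0}\cap\mathcal H_i$, $\mathcal Y_i:=\mathcal D_{i+1}^{\ge 1}\cap\mathcal H_i$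 (a torsion pair in $\mathcal H_i$). For type $(n,0)$ one has $\mathcal D_0=\mathcal D$ and $\mathcal D_n=\mathcal T$. *)

theory Defs
  imports "HOL-Algebra.Group"
begin

section \<open>Categories and functors\<close>

text \<open>Every arrow determines its domain and codomain, so distinct hom-sets are disjoint.
  Composition is written in the order of application of functions: \<open>g \<cdot> f\<close> is "first
  \<open>f\<close>, then \<open>g\<close>".\<close>

record ('o, 'm) category =
  Obj :: "'o set"
  Arr :: "'m set"
  Dom :: "'m \<Rightarrow> 'o"
  Cod :: "'m \<Rightarrow> 'o"
  Ident :: "'o \<Rightarrow> 'm"
  Comp :: "'m \<Rightarrow> 'm \<Rightarrow> 'm"  (infixr \<open>\<cdot>\<index>\<close> 75)

definition Hom :: "('o, 'm, 'z) category_scheme \<Rightarrow> 'o \<Rightarrow> 'o \<Rightarrow> 'm set" where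
  "Hom C x y = {f \<in> Arr C. Dom C f = x \<and> Cod C f = y}"

locale category =
  fixes C :: "('o, 'm, 'z) category_scheme" (structure)
  assumes dom_obj: "f \<in> Arr C \<Longrightarrow> Dom C f \<in> Obj C"
    and cod_obj: "f \<in> Arr C \<Longrightarrow> Cod C f \<in> Obj C"
    and ident_hom: "x \<in> Obj C \<Longrightarrow> Ident C x \<in> Hom C x x"
    and comp_hom: "\<lbrakk>f \<in> Hom C x y; g \<in> Hom C y z\<rbrakk> \<Longrightarrow> g \<cdot> f \<in> Hom C x z"
    and comp_ident_right: "f \<in> Hom C x y \<Longrightarrow> f \<cdot> Ident C x = f"
    and comp_ident_left: "f \<in> Hom C x y \<Longrightarrow> Ident C y \<cdot> f = f"
    and comp_assoc: "\<lbrakk>f \<in> Hom C w x; g \<in> Hom C x y; h \<in> Hom C y z\<rbrakk>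
      \<Longrightarrow> (h \<cdot> g) \<cdot> f = h \<cdot> (g \<cdot> f)"

definition isomorphism :: "('o, 'm, 'z) category_scheme \<Rightarrow> 'm \<Rightarrow> bool" where
  "isomorphism C f \<longleftrightarrow> f \<in> Arr C \<and>
     (\<exists>g \<in> Hom C (Cod C f) (Dom C f).
        g \<cdot>\<^bsub>C\<^esub> f = Ident C (Dom C f) \<and> f \<cdot>\<^bsub>C\<^esub> g = Ident C (Cod C f))"

definition isomorphic :: "('o, 'm, 'z) category_scheme \<Rightarrow> 'o \<Rightarrow> 'o \<Rightarrow> bool" where
  "isomorphic C x y \<longleftrightarrow> (\<exists>f \<in> Hom C x y. isomorphism C f)"

definition zero_object :: "('o, 'm, 'z) category_scheme \<Rightarrow> 'o \<Rightarrow> bool" where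
  "zero_object C z \<longleftrightarrow> z \<in> Obj C \<and>
     (\<forall>x \<in> Obj C. (\<exists>!f. f \<in> Hom C x z) \<and> (\<exists>!f. f \<in> Hom C z x))"

definition full_subcategory ::
  "('o, 'm, 'z) category_scheme \<Rightarrow> 'o set \<Rightarrow> ('o, 'm, 'z) category_scheme" where
  "full_subcategory C S = C\<lparr>Obj := S, Arr := {f \<in> Arr C. Dom C f \<in> S \<and> Cod C f \<in> S}\<rparr>"

record ('o1, 'm1, 'o2, 'm2) cat_functor =
  omap :: "'o1 \<Rightarrow> 'o2"
  amap :: "'m1 \<Rightarrow> 'm2"

definition is_functor ::
  "('o1, 'm1, 'z1) category_scheme \<Rightarrow> ('o2, 'm2, 'z2) category_scheme \<Rightarrow>
   ('o1, 'm1, 'o2, 'm2) cat_functor \<Rightarrow> bool" where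
  "is_functor A B F \<longleftrightarrow>
     (\<forall>x \<in> Obj A. omap F x \<in> Obj B) \<and>
     (\<forall>x y. \<forall>f \<in> Hom A x y. amap F f \<in> Hom B (omap F x) (omap F y)) \<and>
     (\<forall>x \<in> Obj A. amap F (Ident A x) = Ident B (omap F x)) \<and>
     (\<forall>x y z. \<forall>f \<in> Hom A x y. \<forall>g \<in> Hom A y z.
        amap F (g \<cdot>\<^bsub>A\<^esub> f) = amap F g \<cdot>\<^bsub>B\<^esub> amap F f)"

definition natural_transformation ::
  "('o1, 'm1, 'z1) category_scheme \<Rightarrow> ('o2, 'm2, 'z2) category_scheme \<Rightarrow>
   ('o1, 'm1, 'o2, 'm2) cat_functor \<Rightarrow> ('o1, 'm1, 'o2, 'm2) cat_functor \<Rightarrow>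
   ('o1 \<Rightarrow> 'm2) \<Rightarrow> bool" where
  "natural_transformation A B F G \<eta> \<longleftrightarrow>
     (\<forall>x \<in> Obj A. \<eta> x \<in> Hom B (omap F x) (omap G x)) \<and>
     (\<forall>x y. \<forall>f \<in> Hom A x y. \<eta> y \<cdot>\<^bsub>B\<^esub> amap F f = amap G f \<cdot>\<^bsub>B\<^esub> \<eta> x)"


section \<open>Additive categories\<close>

record ('o, 'm) preadditive_category = "('o, 'm) category" +
  hplus :: "'m \<Rightarrow> 'm \<Rightarrow> 'm"
  hzero :: "'o \<Rightarrow> 'o \<Rightarrow> 'm"

definition hom_group ::
  "('o, 'm, 'z) preadditive_category_scheme \<Rightarrow> 'o \<Rightarrow> 'o \<Rightarrow> 'm monoid" where
  "hom_group C x y = \<lparr>carrier = Hom C x y, monoid.mult = hplus C, one = hzero C x y\<rparr>"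

definition hneg :: "('o, 'm, 'z) preadditive_category_scheme \<Rightarrow> 'm \<Rightarrow> 'm" where
  "hneg C f = inv\<^bsub>hom_group C (Dom C f) (Cod C f)\<^esub> f"

definition biproduct ::
  "('o, 'm, 'z) preadditive_category_scheme \<Rightarrow> 'o \<Rightarrow> 'o \<Rightarrow> 'o \<Rightarrow> bool" where
  "biproduct C x y s \<longleftrightarrow> s \<in> Obj C \<and>
     (\<exists>i1 \<in> Hom C x s. \<exists>i2 \<in> Hom C y s. \<exists>p1 \<in> Hom C s x. \<exists>p2 \<in> Hom C s y.
        p1 \<cdot>\<^bsub>C\<^esub> i1 = Ident C x \<and> p2 \<cdot>\<^bsub>C\<^esub> i2 = Ident C y \<and>
        p1 \<cdot>\<^bsub>C\<^esub> i2 = hzero C y x \<and> p2 \<cdot>\<^bsub>C\<^esub> i1 = hzero C x y \<and>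
        hplus C (i1 \<cdot>\<^bsub>C\<^esub> p1) (i2 \<cdot>\<^bsub>C\<^esub> p2) = Ident C s)"

locale additive_category = category C
  for C :: "('o, 'm, 'z) preadditive_category_scheme" (structure) +
  assumes hom_comm_group: "\<lbrakk>x \<in> Obj C; y \<in> Obj C\<rbrakk> \<Longrightarrow> comm_group (hom_group C x y)"
    and comp_hplus_right: "\<lbrakk>f \<in> Hom C x y; f' \<in> Hom C x y; g \<in> Hom C y z\<rbrakk>
      \<Longrightarrow> g \<cdot> hplus C f f' = hplus C (g \<cdot> f) (g \<cdot> f')"
    and comp_hplus_left: "\<lbrakk>f \<in> Hom C x y; g \<in> Hom C y z; g' \<in> Hom C y z\<rbrakk>
      \<Longrightarrow> hplus C g g' \<cdot> f = hplus C (g \<cdot> f) (g' \<cdot> f)"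
    and ex_zero_object: "\<exists>z. zero_object C z"
    and ex_biproduct: "\<lbrakk>x \<in> Obj C; y \<in> Obj C\<rbrakk> \<Longrightarrow> \<exists>s. biproduct C x y s"

definition additive_functor ::
  "('o1, 'm1, 'z1) preadditive_category_scheme \<Rightarrow> ('o2, 'm2, 'z2) preadditive_category_scheme \<Rightarrow>
   ('o1, 'm1, 'o2, 'm2) cat_functor \<Rightarrow> bool" where
  "additive_functor A B F \<longleftrightarrow> is_functor A B F \<and>
     (\<forall>x y. \<forall>f \<in> Hom A x y. \<forall>g \<in> Hom A x y.
        amap F (hplus A f g) = hplus B (amap F f) (amap F g))"

definition is_kernel :: "('o, 'm, 'z) preadditive_category_scheme \<Rightarrow> 'm \<Rightarrow> 'm \<Rightarrow> bool" where
  "is_kernel A k g \<longleftrightarrow> k \<in> Arr A \<and> g \<in> Arr A \<and> Cod A k = Dom A g \<and>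
     g \<cdot>\<^bsub>A\<^esub> k = hzero A (Dom A k) (Cod A g) \<and>
     (\<forall>w. \<forall>h \<in> Hom A w (Dom A g). g \<cdot>\<^bsub>A\<^esub> h = hzero A w (Cod A g) \<longrightarrow>
        (\<exists>!u. u \<in> Hom A w (Dom A k) \<and> k \<cdot>\<^bsub>A\<^esub> u = h))"

definition is_cokernel :: "('o, 'm, 'z) preadditive_category_scheme \<Rightarrow> 'm \<Rightarrow> 'm \<Rightarrow> bool" where
  "is_cokernel A c f \<longleftrightarrow> c \<in> Arr A \<and> f \<in> Arr A \<and> Cod A f = Dom A c \<and>
     c \<cdot>\<^bsub>A\<^esub> f = hzero A (Dom A f) (Cod A c) \<and>
     (\<forall>w. \<forall>h \<in> Hom A (Cod A f) w. h \<cdot>\<^bsub>A\<^esub> f = hzero A (Dom A f) w \<longrightarrow>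
        (\<exists>!u. u \<in> Hom A (Cod A c) w \<and> u \<cdot>\<^bsub>A\<^esub> c = h))"

text \<open>\<open>short_exact A f g\<close>: the sequence \<open>0 \<rightarrow> Dom f \<rightarrow> Cod f = Dom g \<rightarrow> Cod g \<rightarrow> 0\<close> with
  maps \<open>f\<close> and \<open>g\<close> is short exact in the category \<open>A\<close>; both universal properties are tested
  against the objects of \<open>A\<close> only.\<close>

definition short_exact :: "('o, 'm, 'z) preadditive_category_scheme \<Rightarrow> 'm \<Rightarrow> 'm \<Rightarrow> bool" where
  "short_exact A f g \<longleftrightarrow> is_kernel A f g \<and> is_cokernel A g f"


section \<open>Triangulated categories\<close>

text \<open>\<open>shift C i\<close> is the functor \<open>[i]\<close>. The element \<open>(f, g, h)\<close> of \<open>triangles C\<close> is the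
  distinguished triangle \<open>x \<rightarrow> y \<rightarrow> z \<rightarrow> x[1]\<close> with these three maps.\<close>

record ('o, 'm) triangulated_category = "('o, 'm) preadditive_category" +
  shift :: "int \<Rightarrow> ('o, 'm, 'o, 'm) cat_functor"
  triangles :: "('m \<times> 'm \<times> 'm) set"

abbreviation shift_obj ::
  "('o, 'm, 'z) triangulated_category_scheme \<Rightarrow> int \<Rightarrow> 'o \<Rightarrow> 'o" where
  "shift_obj C i \<equiv> omap (shift C i)"

abbreviation shift_arr ::
  "('o, 'm, 'z) triangulated_category_scheme \<Rightarrow> int \<Rightarrow> 'm \<Rightarrow> 'm" where
  "shift_arr C i \<equiv> amap (shift C i)"

definition is_triangle ::
  "('o, 'm, 'z) triangulated_category_scheme \<Rightarrow> 'm \<Rightarrow> 'm \<Rightarrow> 'm \<Rightarrow> bool" where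
  "is_triangle C f g h \<longleftrightarrow> f \<in> Arr C \<and> g \<in> Hom C (Cod C f) (Cod C g) \<and>
     h \<in> Hom C (Cod C g) (shift_obj C 1 (Dom C f))"

definition triangle_morphism ::
  "('o, 'm, 'z) triangulated_category_scheme \<Rightarrow>
   'm \<times> 'm \<times> 'm \<Rightarrow> 'm \<times> 'm \<times> 'm \<Rightarrow> 'm \<Rightarrow> 'm \<Rightarrow> 'm \<Rightarrow> bool" where
  "triangle_morphism C = (\<lambda>(f, g, h) (f', g', h') u v w.
     u \<in> Hom C (Dom C f) (Dom C f') \<and> v \<in> Hom C (Cod C f) (Cod C f') \<and>
     w \<in> Hom C (Cod C g) (Cod C g') \<and>
     v \<cdot>\<^bsub>C\<^esub> f = f' \<cdot>\<^bsub>C\<^esub> u \<and> w \<cdot>\<^bsub>C\<^esub> g = g' \<cdot>\<^bsub>C\<^esub> v \<and>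
     shift_arr C 1 u \<cdot>\<^bsub>C\<^esub> h = h' \<cdot>\<^bsub>C\<^esub> w)"

text \<open>The shift is an additive automorphism together with its strict integer powers. In the
  octahedral axiom the three given triangles are \<open>x \<rightarrow> y \<rightarrow> z' \<rightarrow> x[1]\<close>,
  \<open>y \<rightarrow> z \<rightarrow> x' \<rightarrow> y[1]\<close> and \<open>x \<rightarrow> z \<rightarrow> y' \<rightarrow> x[1]\<close>, and the resulting one is
  \<open>z' \<rightarrow> y' \<rightarrow> x' \<rightarrow> z'[1]\<close>.\<close>

locale triangulated_category = additive_category C
  for C :: "('o, 'm, 'z) triangulated_category_scheme" (structure) +
  assumes shift_functor: "additive_functor C C (shift C i)"
    and shift_obj_0: "x \<in> Obj C \<Longrightarrow> shift_obj C 0 x = x"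
    and shift_arr_0: "f \<in> Arr C \<Longrightarrow> shift_arr C 0 f = f"
    and shift_obj_add: "x \<in> Obj C \<Longrightarrow> shift_obj C i (shift_obj C j x) = shift_obj C (i + j) x"
    and shift_arr_add: "f \<in> Arr C \<Longrightarrow> shift_arr C i (shift_arr C j f) = shift_arr C (i + j) f"
    and triangles_are_triangles: "(f, g, h) \<in> triangles C \<Longrightarrow> is_triangle C f g h"
    and TR1_iso: "\<lbrakk>(f, g, h) \<in> triangles C; is_triangle C f' g' h';
        triangle_morphism C (f, g, h) (f', g', h') u v w;
        isomorphism C u; isomorphism C v; isomorphism C w\<rbrakk> \<Longrightarrow> (f', g', h') \<in> triangles C"
    and TR1_ident: "\<lbrakk>x \<in> Obj C; zero_object C z\<rbrakk>
      \<Longrightarrow> (Ident C x, hzero C x z, hzero C z (shift_obj C 1 x)) \<in> triangles C"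
    and TR1_cone: "f \<in> Arr C \<Longrightarrow> \<exists>g h. (f, g, h) \<in> triangles C"
    and TR2: "is_triangle C f g h
      \<Longrightarrow> (f, g, h) \<in> triangles C \<longleftrightarrow> (g, h, hneg C (shift_arr C 1 f)) \<in> triangles C"
    and TR3: "\<lbrakk>(f, g, h) \<in> triangles C; (f', g', h') \<in> triangles C;
        u \<in> Hom C (Dom C f) (Dom C f'); v \<in> Hom C (Cod C f) (Cod C f'); v \<cdot> f = f' \<cdot> u\<rbrakk>
      \<Longrightarrow> \<exists>w. triangle_morphism C (f, g, h) (f', g', h') u v w"
    and TR4: "\<lbrakk>f \<in> Hom C x y; g \<in> Hom C y z;
        (f, f1, f2) \<in> triangles C; (g, g1, g2) \<in> triangles C; (g \<cdot> f, h1, h2) \<in> triangles C\<rbrakk>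
      \<Longrightarrow> \<exists>a b. (a, b, shift_arr C 1 f1 \<cdot> g2) \<in> triangles C \<and>
            triangle_morphism C (f, f1, f2) (g \<cdot> f, h1, h2) (Ident C x) g a \<and>
            triangle_morphism C (g \<cdot> f, h1, h2) (g, g1, g2) f (Ident C z) b"


section \<open>t-structures\<close>

text \<open>A full subcategory is given by its set of objects.\<close>

definition strictly_full_additive ::
  "('o, 'm, 'z) preadditive_category_scheme \<Rightarrow> 'o set \<Rightarrow> bool" where
  "strictly_full_additive C S \<longleftrightarrow> S \<subseteq> Obj C \<and>
     (\<forall>x y. x \<in> S \<and> isomorphic C x y \<longrightarrow> y \<in> S) \<and>
     (\<forall>z. zero_object C z \<longrightarrow> z \<in> S) \<and>
     (\<forall>x y s. x \<in> S \<and> y \<in> S \<and> biproduct C x y s \<longrightarrow> s \<in> S)"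

definition shift_set ::
  "('o, 'm, 'z) triangulated_category_scheme \<Rightarrow> 'o set \<Rightarrow> int \<Rightarrow> 'o set" where
  "shift_set C S i = shift_obj C i ` S"

text \<open>A pair \<open>D = (D\<^sup>\<le>\<^sup>0, D\<^sup>\<ge>\<^sup>0)\<close> of full subcategories; \<open>tle C D i\<close> and
  \<open>tge C D i\<close> are its shifts \<open>D\<^sup>\<le>\<^sup>i\<close> and \<open>D\<^sup>\<ge>\<^sup>i\<close>.\<close>

type_synonym 'o t_pair = "'o set \<times> 'o set"

abbreviation aisle :: "'o t_pair \<Rightarrow> 'o set" where "aisle D \<equiv> fst D"
abbreviation coaisle :: "'o t_pair \<Rightarrow> 'o set" where "coaisle D \<equiv> snd D"

definition tle :: "('o, 'm, 'z) triangulated_category_scheme \<Rightarrow> 'o t_pair \<Rightarrow> int \<Rightarrow> 'o set" where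
  "tle C D i = shift_set C (aisle D) (- i)"

definition tge :: "('o, 'm, 'z) triangulated_category_scheme \<Rightarrow> 'o t_pair \<Rightarrow> int \<Rightarrow> 'o set" where
  "tge C D i = shift_set C (coaisle D) (- i)"

definition t_structure :: "('o, 'm, 'z) triangulated_category_scheme \<Rightarrow> 'o t_pair \<Rightarrow> bool" where
  "t_structure C D \<longleftrightarrow>
     strictly_full_additive C (aisle D) \<and> strictly_full_additive C (coaisle D) \<and>
     tle C D 0 \<subseteq> tle C D 1 \<and> tge C D 1 \<subseteq> tge C D 0 \<and>
     (\<forall>x \<in> tle C D 0. \<forall>y \<in> tge C D 1. Hom C x y = {hzero C x y}) \<and>
     (\<forall>x \<in> Obj C. \<exists>f g h. (f, g, h) \<in> triangles C \<and>
        Dom C f \<in> tle C D 0 \<and> Cod C f = x \<and> Cod C g \<in> tge C D 1)"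

definition nondegenerate :: "('o, 'm, 'z) triangulated_category_scheme \<Rightarrow> 'o t_pair \<Rightarrow> bool" where
  "nondegenerate C D \<longleftrightarrow>
     (\<Inter>i. tle C D i) = {z. zero_object C z} \<and> (\<Inter>i. tge C D i) = {z. zero_object C z}"

definition heart :: "'o t_pair \<Rightarrow> 'o set" where
  "heart D = aisle D \<inter> coaisle D"

definition of_type ::
  "('o, 'm, 'z) triangulated_category_scheme \<Rightarrow> 'o t_pair \<Rightarrow> 'o t_pair \<Rightarrow> nat \<Rightarrow> int \<Rightarrow> bool" where
  "of_type C D T n k \<longleftrightarrow>
     tle C T k \<subseteq> tle C D 0 \<and> (\<forall>k'. tle C T k' \<subseteq> tle C D 0 \<longrightarrow> k' \<le> k) \<and>
     tle C D (- int n) \<subseteq> tle C T k \<and> (\<forall>n'. tle C D (- int n') \<subseteq> tle C T k \<longrightarrow> n \<le> n')"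


section \<open>Right filterable pairs\<close>

text \<open>All t-structures, including those with co-aisle \<open>D\<^sup>\<ge>\<^sup>i \<inter> T\<^sup>\<ge>\<^sup>0\<close>, are
  required to be non-degenerate.\<close>

definition right_filterable ::
  "('o, 'm, 'z) triangulated_category_scheme \<Rightarrow> 'o t_pair \<Rightarrow> 'o t_pair \<Rightarrow> bool" where
  "right_filterable C D T \<longleftrightarrow>
     (\<forall>i. \<exists>E. t_structure C E \<and> nondegenerate C E \<and> coaisle E = tge C D i \<inter> tge C T 0)"

definition right_basic ::
  "('o, 'm, 'z) triangulated_category_scheme \<Rightarrow> 'o t_pair \<Rightarrow> 'o t_pair \<Rightarrow> int \<Rightarrow> 'o t_pair" where
  "right_basic C D T i =
     (THE E. t_structure C E \<and> nondegenerate C E \<and> coaisle E = tge C D (- i) \<inter> tge C T 0)"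

definition right_basic_heart ::
  "('o, 'm, 'z) triangulated_category_scheme \<Rightarrow> 'o t_pair \<Rightarrow> 'o t_pair \<Rightarrow> int \<Rightarrow> 'o set" where
  "right_basic_heart C D T i = heart (right_basic C D T i)"

definition right_basic_torsion ::
  "('o, 'm, 'z) triangulated_category_scheme \<Rightarrow> 'o t_pair \<Rightarrow> 'o t_pair \<Rightarrow> int \<Rightarrow> 'o set" where
  "right_basic_torsion C D T i =
     tle C (right_basic C D T (i + 1)) 0 \<inter> right_basic_heart C D T i"

definition right_basic_torsion_free ::
  "('o, 'm, 'z) triangulated_category_scheme \<Rightarrow> 'o t_pair \<Rightarrow> 'o t_pair \<Rightarrow> int \<Rightarrow> 'o set" where
  "right_basic_torsion_free C D T i =
     tge C (right_basic C D T (i + 1)) 1 \<inter> right_basic_heart C D T i"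


section \<open>Right t-trees\<close>

text \<open>A vertex is a word \<open>[i\<^sub>1, \<dots>, i\<^sub>l]\<close> over \<open>{0, 1}\<close> of length at most \<open>n\<close>; the root
  is the empty word and the children of \<open>w\<close> are \<open>w @ [0]\<close> and \<open>w @ [1]\<close>. The construction
  is functorial in \<open>X\<close> on the heart of \<open>D\<close>: the vertices \<open>X\<^sub>w\<close> are the values of a functor
  \<open>F w\<close>, and the maps \<open>X\<^bsub>w0\<^esub> \<rightarrow> X\<^sub>w\<close> and \<open>X\<^sub>w \<rightarrow> X\<^bsub>w1\<^esub>\<close> are the components at \<open>X\<close> of natural
  transformations \<open>\<iota> w\<close> and \<open>\<pi> w\<close>.\<close>

definition binary_words :: "nat list set" where
  "binary_words = {w. set w \<subseteq> {0, 1}}"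

definition functorial_right_t_tree ::
  "('o, 'm, 'z) triangulated_category_scheme \<Rightarrow> 'o t_pair \<Rightarrow> 'o t_pair \<Rightarrow> nat \<Rightarrow>
   (nat list \<Rightarrow> ('o, 'm, 'o, 'm) cat_functor) \<Rightarrow>
   (nat list \<Rightarrow> 'o \<Rightarrow> 'm) \<Rightarrow> (nat list \<Rightarrow> 'o \<Rightarrow> 'm) \<Rightarrow> bool" where
  "functorial_right_t_tree C D T n F \<iota> \<pi> \<longleftrightarrow>
     (let HD = full_subcategory C (heart D) in
       (\<forall>w \<in> binary_words. length w \<le> n \<longrightarrow> is_functor HD C (F w)) \<and>
       (\<forall>X \<in> Obj HD. omap (F []) X = X) \<and> (\<forall>f \<in> Arr HD. amap (F []) f = f) \<and>
       (\<forall>w \<in> binary_words. length w < n \<longrightarrow>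
          natural_transformation HD C (F (w @ [0])) (F w) (\<iota> w) \<and>
          natural_transformation HD C (F w) (F (w @ [1])) (\<pi> w) \<and>
          (let l = int (length w); s = int (sum_list w) in
            \<forall>X \<in> heart D.
              short_exact (full_subcategory C (shift_set C (right_basic_heart C D T l) (- s)))
                (\<iota> w X) (\<pi> w X) \<and>
              omap (F (w @ [0])) X \<in> shift_set C (right_basic_torsion C D T l) (- s) \<and>
              omap (F (w @ [1])) X \<in> shift_set C (right_basic_torsion_free C D T l) (- s))))"

end

theory Submission
  imports Defs
begin

text \<open>
  The type condition gives \<open>\<T>\<^sup>\<le>\<^sup>0 \<subseteq> \<D>\<^sup>\<le>\<^sup>0\<close>, hence \<open>\<D>\<^sup>\<ge>\<^sup>0 \<subseteq> \<T>\<^sup>\<ge>\<^sup>0\<close>, so that the right basic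
  t-structure \<open>\<D>\<^sub>0\<close> is \<open>\<D>\<close> itself (\<open>right_basic_0\<close>). Consecutive right basic t-structures
  \<open>E = \<D>\<^sub>l\<close> and \<open>E' = \<D>\<^bsub>l+1\<^esub>\<close> are at distance at most one: from
  \<open>\<D>\<^sub>i\<^sup>\<ge>\<^sup>0 = \<D>\<^bsup>\<ge>-i\<^esup> \<inter> \<T>\<^sup>\<ge>\<^sup>0\<close> one reads off \<open>E'\<^sup>\<ge>\<^sup>1 \<subseteq> E\<^sup>\<ge>\<^sup>0 \<subseteq> E'\<^sup>\<ge>\<^sup>0\<close>, and dually
  \<open>E'\<^sup>\<le>\<^sup>0 \<subseteq> E\<^sup>\<le>\<^sup>0 \<subseteq> E'\<^sup>\<le>\<^sup>1\<close> because \<open>E\<^sup>\<le>\<^sup>0\<close> is the left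
  orthogonal of \<open>E\<^sup>\<ge>\<^sup>1\<close>.

  For such a neighbouring pair, truncate an object \<open>x\<close> of the heart of \<open>E\<close> with respect to
  \<open>E'\<close>. The distances force both outer terms of the truncation triangle into the heart of
  \<open>E\<close> (\<open>truncation_in_heart\<close>), and a distinguished triangle with all three terms in a
  heart is a short exact sequence there (\<open>triangle_in_heart_short_exact\<close>): this is the sequence
  of \<open>x\<close> for the torsion pair. Moreover the torsion part lies in the heart of \<open>E'\<close>, and the
  torsion-free part in the heart of \<open>E'\<close> shifted by \<open>[-1]\<close> (\<open>torsion_in_next_heart\<close>,
  \<open>torsion_free_in_next_heart\<close>). So each child can be truncated again at the next t-structure
  after undoing a shift that grows by one with every letter \<open>1\<close>, and the tree arises by recursion
  on the word; the shift carries the short exact sequences back (\<open>shift_short_exact\<close>).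
  Functoriality comes from the uniqueness of factorisations through truncations.

  The geometry of triangles enters through the fact that \<open>Hom\<close> in either variable turns a
  distinguished triangle into an exact sequence; closure of aisles and co-aisles under extensions
  is a consequence of this, since both are orthogonals.
\<close>

section \<open>Zero maps and differences in additive categories\<close>

lemma Hom_D: "f \<in> Hom C x y \<Longrightarrow> f \<in> Arr C \<and> Dom C f = x \<and> Cod C f = y"
  by (simp add: Hom_def)

lemma (in category) Hom_objects: "f \<in> Hom C x y \<Longrightarrow> x \<in> Obj C \<and> y \<in> Obj C"
  using dom_obj cod_obj by (auto simp: Hom_def)

lemma (in category) isomorphicI:
  assumes "f \<in> Hom C x y" "g \<in> Hom C y x" "g \<cdot> f = Ident C x" "f \<cdot> g = Ident C y"
  shows "isomorphic C x y"
  using assms unfolding isomorphic_def isomorphism_def by (auto dest: Hom_D)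

context additive_category
begin

lemma hzero_hom: "\<lbrakk>x \<in> Obj C; y \<in> Obj C\<rbrakk> \<Longrightarrow> hzero C x y \<in> Hom C x y"
  using monoid.one_closed[OF comm_monoid.axioms(1)[OF comm_group.axioms(1)[OF hom_comm_group]]]
  by (simp add: hom_group_def)

lemma hplus_idem_zero:
  assumes "f \<in> Hom C x y" "hplus C f f = f"
  shows "f = hzero C x y"
proof -
  interpret G: comm_group "hom_group C x y"
    using assms Hom_objects hom_comm_group by blast
  show ?thesis
    using G.l_cancel_one[of f f] assms by (simp add: hom_group_def)
qed

lemma hplus_zero_zero:
  assumes "x \<in> Obj C" "y \<in> Obj C"
  shows "hplus C (hzero C x y) (hzero C x y) = hzero C x y"
proof -
  interpret G: comm_group "hom_group C x y"
    using assms hom_comm_group by blast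
  show ?thesis
    using G.l_one[OF G.one_closed] by (simp add: hom_group_def)
qed

lemma comp_hzero_right:
  assumes "g \<in> Hom C y z" "x \<in> Obj C"
  shows "g \<cdot> hzero C x y = hzero C x z"
proof (rule hplus_idem_zero)
  have y: "y \<in> Obj C" using assms Hom_objects by blast
  then have 0: "hzero C x y \<in> Hom C x y" using assms hzero_hom by blast
  then show "g \<cdot> hzero C x y \<in> Hom C x z" using assms comp_hom by blast
  show "hplus C (g \<cdot> hzero C x y) (g \<cdot> hzero C x y) = g \<cdot> hzero C x y"
    using comp_hplus_right[OF 0 0 assms(1)] hplus_zero_zero[OF assms(2) y] by simp
qed

lemma comp_hzero_left:
  assumes "f \<in> Hom C x y" "z \<in> Obj C"
  shows "hzero C y z \<cdot> f = hzero C x z"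
proof (rule hplus_idem_zero)
  have y: "y \<in> Obj C" using assms Hom_objects by blast
  then have 0: "hzero C y z \<in> Hom C y z" using assms hzero_hom by blast
  then show "hzero C y z \<cdot> f \<in> Hom C x z" using assms comp_hom by blast
  show "hplus C (hzero C y z \<cdot> f) (hzero C y z \<cdot> f) = hzero C y z \<cdot> f"
    using comp_hplus_left[OF assms(1) 0 0] hplus_zero_zero[OF y assms(2)] by simp
qed

lemma ex_difference:
  assumes "a \<in> Hom C x y" "a' \<in> Hom C x y"
  shows "\<exists>d \<in> Hom C x y. hplus C d a' = a"
proof -
  interpret G: comm_group "hom_group C x y"
    using assms Hom_objects hom_comm_group by blast
  have "a \<otimes>\<^bsub>hom_group C x y\<^esub> inv\<^bsub>hom_group C x y\<^esub> a' \<otimes>\<^bsub>hom_group C x y\<^esub> a' = a"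
    using assms by (simp add: hom_group_def G.m_assoc[unfolded hom_group_def, simplified]
        G.l_inv[unfolded hom_group_def, simplified] G.inv_closed[unfolded hom_group_def, simplified]
        G.r_one[unfolded hom_group_def, simplified])
  moreover have "a \<otimes>\<^bsub>hom_group C x y\<^esub> inv\<^bsub>hom_group C x y\<^esub> a' \<in> carrier (hom_group C x y)"
    using assms by (intro G.m_closed G.inv_closed) (auto simp: hom_group_def)
  ultimately show ?thesis by (auto simp: hom_group_def)
qed

lemma hplus_cancel_zero:
  assumes "d \<in> Hom C x y" "a \<in> Hom C x y" "hplus C d a = a"
  shows "d = hzero C x y"
proof -
  interpret G: comm_group "hom_group C x y"
    using assms Hom_objects hom_comm_group by blast
  show ?thesis
    using G.r_cancel_one[of a d] assms by (simp add: hom_group_def)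
qed

lemma hplus_zero_left:
  assumes "a \<in> Hom C x y"
  shows "hplus C (hzero C x y) a = a"
proof -
  interpret G: comm_group "hom_group C x y"
    using assms Hom_objects hom_comm_group by blast
  show ?thesis
    using G.l_one[of a] assms by (simp add: hom_group_def)
qed

lemma cancel_left_if_zero_kernel:
  assumes f: "f \<in> Hom C y z"
    and ker: "\<And>d. \<lbrakk>d \<in> Hom C x y; f \<cdot> d = hzero C x z\<rbrakk> \<Longrightarrow> d = hzero C x y"
    and a: "a \<in> Hom C x y" and a': "a' \<in> Hom C x y" and eq: "f \<cdot> a = f \<cdot> a'"
  shows "a = a'"
proof -
  obtain d where d: "d \<in> Hom C x y" "hplus C d a' = a" using ex_difference[OF a a'] by blast
  have "hplus C (f \<cdot> d) (f \<cdot> a') = f \<cdot> a'"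
    using comp_hplus_right[OF d(1) a' f] d(2) eq by simp
  then have "f \<cdot> d = hzero C x z"
    using hplus_cancel_zero comp_hom d(1) a' f by meson
  then show ?thesis using ker[OF d(1)] d(2) hplus_zero_left[OF a'] by simp
qed

lemma cancel_right_if_zero_cokernel:
  assumes f: "f \<in> Hom C x y"
    and coker: "\<And>d. \<lbrakk>d \<in> Hom C y z; d \<cdot> f = hzero C x z\<rbrakk> \<Longrightarrow> d = hzero C y z"
    and a: "a \<in> Hom C y z" and a': "a' \<in> Hom C y z" and eq: "a \<cdot> f = a' \<cdot> f"
  shows "a = a'"
proof -
  obtain d where d: "d \<in> Hom C y z" "hplus C d a' = a" using ex_difference[OF a a'] by blast
  have "hplus C (d \<cdot> f) (a' \<cdot> f) = a' \<cdot> f"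
    using comp_hplus_left[OF f d(1) a'] d(2) eq by simp
  then have "d \<cdot> f = hzero C x z"
    using hplus_cancel_zero comp_hom d(1) a' f by meson
  then show ?thesis using coker[OF d(1)] d(2) hplus_zero_left[OF a'] by simp
qed

lemma hneg_hom:
  assumes "f \<in> Hom C x y"
  shows "hneg C f \<in> Hom C x y"
proof -
  interpret G: comm_group "hom_group C x y"
    using assms Hom_objects hom_comm_group by blast
  show ?thesis
    using G.inv_closed[of f] assms Hom_D[OF assms] by (simp add: hom_group_def hneg_def)
qed

lemma hplus_hneg:
  assumes "f \<in> Hom C x y"
  shows "hplus C f (hneg C f) = hzero C x y" "hplus C (hneg C f) f = hzero C x y"
proof -
  interpret G: comm_group "hom_group C x y"
    using assms Hom_objects hom_comm_group by blast
  show "hplus C f (hneg C f) = hzero C x y" "hplus C (hneg C f) f = hzero C x y"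
    using G.r_inv[of f] G.l_inv[of f] assms Hom_D[OF assms]
    by (simp_all add: hom_group_def hneg_def)
qed

lemma hneg_unique:
  assumes "f \<in> Hom C x y" "g \<in> Hom C x y" "hplus C g f = hzero C x y"
  shows "hneg C f = g"
proof -
  interpret G: comm_group "hom_group C x y"
    using assms Hom_objects hom_comm_group by blast
  show ?thesis
    using G.inv_equality[of g f] assms Hom_D[OF assms(1)] by (simp add: hom_group_def hneg_def)
qed

lemma hneg_hneg: "f \<in> Hom C x y \<Longrightarrow> hneg C (hneg C f) = f"
  by (rule hneg_unique[OF hneg_hom]) (auto simp: hplus_hneg)

lemma hneg_hzero: "\<lbrakk>x \<in> Obj C; y \<in> Obj C\<rbrakk> \<Longrightarrow> hneg C (hzero C x y) = hzero C x y"
  by (rule hneg_unique[OF hzero_hom hzero_hom]) (auto simp: hplus_zero_zero)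

lemma comp_hneg_left:
  assumes "f \<in> Hom C x y" "g \<in> Hom C y z"
  shows "hneg C g \<cdot> f = hneg C (g \<cdot> f)"
proof (rule hneg_unique[symmetric])
  show "hplus C (hneg C g \<cdot> f) (g \<cdot> f) = hzero C x z"
    using assms comp_hplus_left[OF assms(1) hneg_hom[OF assms(2)] assms(2)]
      hplus_hneg(2)[OF assms(2)] comp_hzero_left[OF assms(1)] Hom_objects by fastforce
qed (use assms comp_hom hneg_hom in blast)+

lemma comp_hneg_right:
  assumes "f \<in> Hom C x y" "g \<in> Hom C y z"
  shows "g \<cdot> hneg C f = hneg C (g \<cdot> f)"
proof (rule hneg_unique[symmetric])
  show "hplus C (g \<cdot> hneg C f) (g \<cdot> f) = hzero C x z"
    using assms comp_hplus_right[OF hneg_hom[OF assms(1)] assms(1) assms(2)]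
      hplus_hneg(2)[OF assms(1)] comp_hzero_right[OF assms(2)] Hom_objects by fastforce
qed (use assms comp_hom hneg_hom in blast)+

lemma zero_object_maps:
  assumes "zero_object C z" "f \<in> Hom C x y" "x = z \<or> y = z"
  shows "f = hzero C x y"
  using assms hzero_hom Hom_objects unfolding zero_object_def by metis

end


section \<open>The shift as an additive automorphism\<close>

context triangulated_category
begin

lemma shift_hom: "f \<in> Hom C x y \<Longrightarrow> shift_arr C i f \<in> Hom C (shift_obj C i x) (shift_obj C i y)"
  using shift_functor unfolding additive_functor_def is_functor_def by blast

lemma shift_obj_in: "x \<in> Obj C \<Longrightarrow> shift_obj C i x \<in> Obj C"
  using shift_functor unfolding additive_functor_def is_functor_def by blast

lemma shift_comp:
  "\<lbrakk>f \<in> Hom C x y; g \<in> Hom C y z\<rbrakk> \<Longrightarrow> shift_arr C i (g \<cdot> f) = shift_arr C i g \<cdot> shift_arr C i f"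
  using shift_functor unfolding additive_functor_def is_functor_def by blast

lemma shift_ident: "x \<in> Obj C \<Longrightarrow> shift_arr C i (Ident C x) = Ident C (shift_obj C i x)"
  using shift_functor unfolding additive_functor_def is_functor_def by blast

lemma shift_hzero:
  assumes "x \<in> Obj C" "y \<in> Obj C"
  shows "shift_arr C i (hzero C x y) = hzero C (shift_obj C i x) (shift_obj C i y)"
proof (rule hplus_idem_zero)
  have "shift_arr C i (hplus C (hzero C x y) (hzero C x y))
      = hplus C (shift_arr C i (hzero C x y)) (shift_arr C i (hzero C x y))"
    using shift_functor hzero_hom[OF assms] unfolding additive_functor_def by blast
  then show "hplus C (shift_arr C i (hzero C x y)) (shift_arr C i (hzero C x y))
      = shift_arr C i (hzero C x y)"
    using hplus_zero_zero[OF assms] by simp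
qed (use assms hzero_hom shift_hom in blast)

lemma shift_obj_cancel:
  "x \<in> Obj C \<Longrightarrow> shift_obj C (- i) (shift_obj C i x) = x"
  "x \<in> Obj C \<Longrightarrow> shift_obj C i (shift_obj C (- i) x) = x"
  by (simp_all add: shift_obj_add shift_obj_0)

lemma shift_arr_cancel:
  "f \<in> Arr C \<Longrightarrow> shift_arr C (- i) (shift_arr C i f) = f"
  "f \<in> Arr C \<Longrightarrow> shift_arr C i (shift_arr C (- i) f) = f"
  by (simp_all add: shift_arr_add shift_arr_0)

lemma shift_faithful:
  assumes "f \<in> Hom C x y" "g \<in> Hom C x' y'" "shift_arr C i f = shift_arr C i g"
  shows "f = g"
  using assms shift_arr_cancel(1) by (metis Hom_D)

lemma shift_zero_iff:
  assumes "f \<in> Hom C x y"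
  shows "shift_arr C i f = hzero C (shift_obj C i x) (shift_obj C i y) \<longleftrightarrow> f = hzero C x y"
  using assms shift_faithful[OF assms] shift_hzero hzero_hom Hom_objects by metis

lemma shift_full:
  assumes "f \<in> Hom C (shift_obj C i x) (shift_obj C i y)" "x \<in> Obj C" "y \<in> Obj C"
  shows "\<exists>g \<in> Hom C x y. shift_arr C i g = f"
proof
  show "shift_arr C (- i) f \<in> Hom C x y"
    using shift_hom[OF assms(1), of "- i"] assms(2,3) by (simp add: shift_obj_cancel)
  show "shift_arr C i (shift_arr C (- i) f) = f"
    using assms(1) by (auto simp: shift_arr_cancel dest: Hom_D)
qed

lemma shift_hom_unshift:
  assumes "f \<in> Hom C (shift_obj C i x) y" "x \<in> Obj C"
  shows "shift_arr C (- i) f \<in> Hom C x (shift_obj C (- i) y)"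
  using shift_hom[OF assms(1), of "- i"] assms(2) by (simp add: shift_obj_cancel)

lemma shift_hom_unshift_right:
  assumes "f \<in> Hom C x (shift_obj C i y)" "y \<in> Obj C"
  shows "shift_arr C (- i) f \<in> Hom C (shift_obj C (- i) x) y"
  using shift_hom[OF assms(1), of "- i"] assms(2) by (simp add: shift_obj_cancel)

lemma shift_zero_object:
  assumes z: "zero_object C z"
  shows "zero_object C (shift_obj C i z)"
  unfolding zero_object_def
proof (intro conjI ballI)
  have zO: "z \<in> Obj C" using z by (simp add: zero_object_def)
  show "shift_obj C i z \<in> Obj C" using shift_obj_in zO by blast
  fix x assume x: "x \<in> Obj C"
  have "f = hzero C x (shift_obj C i z)" if f: "f \<in> Hom C x (shift_obj C i z)" for f
  proof -
    have "shift_arr C (- i) f = hzero C (shift_obj C (- i) x) (shift_obj C (- i) (shift_obj C i z))"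
      using shift_hom_unshift_right[OF f zO] zero_object_maps[OF z] shift_obj_cancel zO by metis
    then show ?thesis using shift_zero_iff[OF f] by blast
  qed
  then show "\<exists>!f. f \<in> Hom C x (shift_obj C i z)"
    using hzero_hom x shift_obj_in[OF zO] by metis
  have "f = hzero C (shift_obj C i z) x" if f: "f \<in> Hom C (shift_obj C i z) x" for f
  proof -
    have "shift_arr C (- i) f = hzero C (shift_obj C (- i) (shift_obj C i z)) (shift_obj C (- i) x)"
      using shift_hom_unshift[OF f zO] zero_object_maps[OF z] shift_obj_cancel zO by metis
    then show ?thesis using shift_zero_iff[OF f] by blast
  qed
  then show "\<exists>!f. f \<in> Hom C (shift_obj C i z) x"
    using hzero_hom x shift_obj_in[OF zO] by metis
qed

lemma shift_isomorphic:
  assumes "isomorphic C x y"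
  shows "isomorphic C (shift_obj C i x) (shift_obj C i y)"
proof -
  obtain f g where f: "f \<in> Hom C x y" and g: "g \<in> Hom C y x"
    and "g \<cdot> f = Ident C x" "f \<cdot> g = Ident C y"
    using assms unfolding isomorphic_def isomorphism_def by (auto dest: Hom_D)
  then show ?thesis
    using isomorphicI[OF shift_hom[OF f] shift_hom[OF g], of i]
      shift_comp[OF f g, of i] shift_comp[OF g f, of i] shift_ident Hom_objects by metis
qed


section \<open>Exactness of Hom on distinguished triangles\<close>

lemma triangle_homs:
  assumes "(f, g, h) \<in> triangles C"
  shows "f \<in> Hom C (Dom C f) (Cod C f)" "g \<in> Hom C (Cod C f) (Cod C g)"
    "h \<in> Hom C (Cod C g) (shift_obj C 1 (Dom C f))"
  using triangles_are_triangles[OF assms] by (auto simp: is_triangle_def Hom_def)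

lemma triangle_rotate:
  "(f, g, h) \<in> triangles C \<Longrightarrow> (g, h, hneg C (shift_arr C 1 f)) \<in> triangles C"
  using TR2 triangles_are_triangles by blast

text \<open>A map \<open>u : w \<rightarrow> y\<close> killed by \<open>g\<close> is the first component of a morphism from the rotated
  trivial triangle \<open>w \<rightarrow> 0 \<rightarrow> w[1]\<close> to \<open>y \<rightarrow> z \<rightarrow> x[1]\<close>; the third component is the shift of a lift
  of \<open>u\<close> through \<open>f\<close>.\<close>

lemma triangle_weak_kernel:
  assumes t: "(f, g, h) \<in> triangles C"
    and u: "u \<in> Hom C w (Cod C f)" and gu: "g \<cdot> u = hzero C w (Cod C g)"
  shows "\<exists>v \<in> Hom C w (Dom C f). f \<cdot> v = u"
proof -
  let ?s = "shift_obj C 1" and ?S = "shift_arr C 1"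
  obtain z where z: "zero_object C z" using ex_zero_object by blast
  then have zO: "z \<in> Obj C" by (simp add: zero_object_def)
  note F = triangle_homs(1)[OF t] and G = triangle_homs(2)[OF t] and H = triangle_homs(3)[OF t]
  have w: "w \<in> Obj C" and y: "Cod C f \<in> Obj C" and z': "Cod C g \<in> Obj C" and x: "Dom C f \<in> Obj C"
    using u G F Hom_objects by blast+
  have 0: "hzero C w z \<in> Hom C w z" and 00: "hzero C z (Cod C g) \<in> Hom C z (Cod C g)"
    using hzero_hom w zO z' by blast+
  have "hzero C z (Cod C g) \<cdot> hzero C w z = g \<cdot> u"
    using comp_hzero_right[OF 00 w] gu by simp
  then obtain r where r: "triangle_morphism C
      (hzero C w z, hzero C z (?s w), hneg C (?S (Ident C w))) (g, h, hneg C (?S f))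
      u (hzero C z (Cod C g)) r"
    using TR3[OF triangle_rotate[OF TR1_ident[OF w z]] triangle_rotate[OF t], of u "hzero C z (Cod C g)"]
      u 00 0 Hom_D[OF G] Hom_D[OF 0] by auto
  have 000: "hzero C z (?s w) \<in> Hom C z (?s w)" using hzero_hom zO shift_obj_in w by blast
  have rh: "r \<in> Hom C (?s w) (?s (Dom C f))"
    and re: "?S u \<cdot> hneg C (?S (Ident C w)) = hneg C (?S f) \<cdot> r"
    using r Hom_D[OF 000] Hom_D[OF H] by (auto simp: triangle_morphism_def)
  have "?S u \<cdot> hneg C (?S (Ident C w)) = hneg C (?S u)"
    using comp_hneg_right[OF shift_hom[OF ident_hom[OF w]] shift_hom[OF u]]
      shift_comp[OF ident_hom[OF w] u, of 1] comp_ident_right[OF u] by simp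
  moreover have "hneg C (?S f) \<cdot> r = hneg C (?S f \<cdot> r)"
    using comp_hneg_left[OF rh shift_hom[OF F]] by simp
  ultimately have "?S u = ?S f \<cdot> r"
    using re hneg_hneg[OF shift_hom[OF u, of 1]]
      hneg_hneg[OF comp_hom[OF rh shift_hom[OF F]]] by metis
  moreover obtain v where v: "v \<in> Hom C w (Dom C f)" "?S v = r" using shift_full[OF rh w x] by blast
  ultimately have "?S u = ?S (f \<cdot> v)" using shift_comp[OF v(1) F] by simp
  then have "f \<cdot> v = u" using shift_faithful[OF u comp_hom[OF v(1) F]] by blast
  then show ?thesis using v by blast
qed

text \<open>Dually, a map out of \<open>y\<close> that kills \<open>f\<close> extends to a morphism into the triangle
  \<open>0 \<rightarrow> w \<rightarrow> w \<rightarrow> 0\<close>, whose third component is the factorisation.\<close>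

lemma triangle_weak_cokernel:
  assumes t: "(f, g, h) \<in> triangles C"
    and u: "u \<in> Hom C (Cod C f) w" and uf: "u \<cdot> f = hzero C (Dom C f) w"
  shows "\<exists>v \<in> Hom C (Cod C g) w. v \<cdot> g = u"
proof -
  let ?s = "shift_obj C 1" and ?S = "shift_arr C 1"
  obtain z where z: "zero_object C z" using ex_zero_object by blast
  then have zO: "z \<in> Obj C" by (simp add: zero_object_def)
  note F = triangle_homs(1)[OF t] and G = triangle_homs(2)[OF t] and H = triangle_homs(3)[OF t]
  have w: "w \<in> Obj C" and x: "Dom C f \<in> Obj C"
    using u F Hom_objects by blast+
  have szO: "?s z \<in> Obj C" using zO shift_obj_in by blast
  have i: "hzero C z w \<in> Hom C z w" using hzero_hom zO w by blast
  have j: "Ident C w \<in> Hom C w w" using ident_hom w by blast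
  have k: "hzero C w (?s z) \<in> Hom C w (?s z)" using hzero_hom w szO by blast
  have tri: "is_triangle C (hzero C z w) (Ident C w) (hzero C w (?s z))"
    using i j k by (auto simp: is_triangle_def Hom_def)
  have "hneg C (?S (hzero C z w)) = hzero C (?s z) (?s w)"
    using shift_hzero[OF zO w] hneg_hzero szO shift_obj_in[OF w] by simp
  \<comment> \<open>Its rotation is the trivial triangle on \<open>w\<close> with the zero object \<open>z[1]\<close>.\<close>
  then have "(hzero C z w, Ident C w, hzero C w (?s z)) \<in> triangles C"
    using TR2[OF tri] TR1_ident[OF w shift_zero_object[OF z]] by simp
  moreover have p: "hzero C (Dom C f) z \<in> Hom C (Dom C f) z" using hzero_hom x zO by blast
  moreover have "u \<cdot> f = hzero C z w \<cdot> hzero C (Dom C f) z"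
    using uf comp_hzero_right[OF i x] by simp
  ultimately obtain v where "triangle_morphism C (f, g, h)
      (hzero C z w, Ident C w, hzero C w (?s z)) (hzero C (Dom C f) z) u v"
    using TR3[OF t, of "hzero C z w" "Ident C w" "hzero C w (?s z)" "hzero C (Dom C f) z" u]
      Hom_D[OF i] u by auto
  then have "v \<in> Hom C (Cod C g) w" "v \<cdot> g = u"
    using Hom_D[OF j] comp_ident_left[OF u] by (auto simp: triangle_morphism_def)
  then show ?thesis by blast
qed

lemma triangle_comp_zero:
  assumes t: "(f, g, h) \<in> triangles C"
  shows "g \<cdot> f = hzero C (Dom C f) (Cod C g)"
proof -
  obtain z where z: "zero_object C z" using ex_zero_object by blast
  then have zO: "z \<in> Obj C" by (simp add: zero_object_def)
  note F = triangle_homs(1)[OF t] and G = triangle_homs(2)[OF t]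
  have x: "Dom C f \<in> Obj C" and z': "Cod C g \<in> Obj C" using F G Hom_objects by blast+
  have 0: "hzero C (Dom C f) z \<in> Hom C (Dom C f) z" using hzero_hom x zO by blast
  note I = ident_hom[OF x]
  obtain w where w: "triangle_morphism C
      (Ident C (Dom C f), hzero C (Dom C f) z, hzero C z (shift_obj C 1 (Dom C f))) (f, g, h)
      (Ident C (Dom C f)) f w"
    using TR3[OF TR1_ident[OF x z] t, of "Ident C (Dom C f)" f] F I Hom_D[OF I] by auto
  then have "w \<in> Hom C z (Cod C g)" "w \<cdot> hzero C (Dom C f) z = g \<cdot> f"
    using Hom_D[OF 0] by (auto simp: triangle_morphism_def)
  then show ?thesis using comp_hzero_right[OF _ x] by metis
qed

text \<open>Rotation turns exactness at the middle term into exactness at the outer ones, which measures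
  by the connecting map how far the first map is from a monomorphism and the second from an
  epimorphism. Where maps out of a shift vanish, factorisations therefore become unique.\<close>

lemma triangle_kernel_of_first:
  assumes t: "(f, g, h) \<in> triangles C"
    and d: "d \<in> Hom C w (Dom C f)" and fd: "f \<cdot> d = hzero C w (Cod C f)"
  shows "\<exists>e \<in> Hom C (shift_obj C 1 w) (Cod C g). h \<cdot> e = shift_arr C 1 d"
proof -
  let ?S = "shift_arr C 1"
  note F = triangle_homs(1)[OF t] and G = triangle_homs(2)[OF t] and H = triangle_homs(3)[OF t]
  have wO: "w \<in> Obj C" and y: "Cod C f \<in> Obj C" using d F Hom_objects by blast+
  have t': "(h, hneg C (?S f), hneg C (?S g)) \<in> triangles C"
    using t triangle_rotate by blast
  have SF: "?S f \<in> Hom C (shift_obj C 1 (Dom C f)) (shift_obj C 1 (Cod C f))"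
    and SD: "?S d \<in> Hom C (shift_obj C 1 w) (shift_obj C 1 (Dom C f))"
    using F d shift_hom by blast+
  have "hneg C (?S f) \<cdot> ?S d = hzero C (shift_obj C 1 w) (shift_obj C 1 (Cod C f))"
    using comp_hneg_left[OF SD SF] shift_comp[OF d F, of 1] fd shift_hzero[OF wO y, of 1]
      hneg_hzero[OF shift_obj_in[OF wO] shift_obj_in[OF y], of 1 1] by simp
  then show ?thesis
    using triangle_weak_kernel[OF t', of "?S d" "shift_obj C 1 w"] SD
      Hom_D[OF H] Hom_D[OF hneg_hom[OF SF]] by auto
qed

lemma triangle_cokernel_of_second:
  assumes t: "(f, g, h) \<in> triangles C"
    and d: "d \<in> Hom C (Cod C g) w" and dg: "d \<cdot> g = hzero C (Cod C f) w"
  shows "\<exists>e \<in> Hom C (shift_obj C 1 (Dom C f)) w. e \<cdot> h = d"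
  using triangle_weak_cokernel[OF triangle_rotate[OF t], of d w] d dg
    Hom_D[OF triangle_homs(2)[OF t]] Hom_D[OF triangle_homs(3)[OF t]] by auto

lemma triangle_first_cancel:
  assumes t: "(f, g, h) \<in> triangles C"
    and van: "\<And>e. e \<in> Hom C (shift_obj C 1 w) (Cod C g) \<Longrightarrow> e = hzero C (shift_obj C 1 w) (Cod C g)"
    and a: "a \<in> Hom C w (Dom C f)" and a': "a' \<in> Hom C w (Dom C f)" and eq: "f \<cdot> a = f \<cdot> a'"
  shows "a = a'"
proof (rule cancel_left_if_zero_kernel[OF triangle_homs(1)[OF t] _ a a' eq])
  fix d assume d: "d \<in> Hom C w (Dom C f)" "f \<cdot> d = hzero C w (Cod C f)"
  obtain e where e: "e \<in> Hom C (shift_obj C 1 w) (Cod C g)" "h \<cdot> e = shift_arr C 1 d"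
    using triangle_kernel_of_first[OF t d] by blast
  have "shift_arr C 1 d = hzero C (shift_obj C 1 w) (shift_obj C 1 (Dom C f))"
    using e van[OF e(1)] comp_hzero_right[OF triangle_homs(3)[OF t]] Hom_objects[OF e(1)] by metis
  then show "d = hzero C w (Dom C f)" using shift_zero_iff[OF d(1)] by blast
qed

lemma triangle_second_cancel:
  assumes t: "(f, g, h) \<in> triangles C"
    and van: "\<And>e. e \<in> Hom C (shift_obj C 1 (Dom C f)) w \<Longrightarrow> e = hzero C (shift_obj C 1 (Dom C f)) w"
    and a: "a \<in> Hom C (Cod C g) w" and a': "a' \<in> Hom C (Cod C g) w" and eq: "a \<cdot> g = a' \<cdot> g"
  shows "a = a'"
proof (rule cancel_right_if_zero_cokernel[OF triangle_homs(2)[OF t] _ a a' eq])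
  fix d assume d: "d \<in> Hom C (Cod C g) w" "d \<cdot> g = hzero C (Cod C f) w"
  obtain e where e: "e \<in> Hom C (shift_obj C 1 (Dom C f)) w" "e \<cdot> h = d"
    using triangle_cokernel_of_second[OF t d] by blast
  then show "d = hzero C (Cod C g) w"
    using van[OF e(1)] comp_hzero_left[OF triangle_homs(3)[OF t]] Hom_objects[OF e(1)] by metis
qed


section \<open>Truncation with respect to a t-structure\<close>

lemma mem_shift_set:
  assumes "S \<subseteq> Obj C"
  shows "x \<in> shift_set C S i \<longleftrightarrow> x \<in> Obj C \<and> shift_obj C (- i) x \<in> S"
proof
  assume "x \<in> shift_set C S i"
  then obtain y where "y \<in> S" "x = shift_obj C i y" by (auto simp: shift_set_def)
  then show "x \<in> Obj C \<and> shift_obj C (- i) x \<in> S"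
    using assms shift_obj_in shift_obj_cancel(1) by auto
next
  assume "x \<in> Obj C \<and> shift_obj C (- i) x \<in> S"
  then show "x \<in> shift_set C S i"
    unfolding shift_set_def using shift_obj_cancel(2) by (metis imageI)
qed

lemma t_structure_subset:
  assumes "t_structure C E"
  shows "aisle E \<subseteq> Obj C" "coaisle E \<subseteq> Obj C"
  using assms by (auto simp: t_structure_def strictly_full_additive_def)

lemma mem_tle:
  assumes "t_structure C E"
  shows "x \<in> tle C E i \<longleftrightarrow> x \<in> Obj C \<and> shift_obj C i x \<in> aisle E"
  using mem_shift_set[OF t_structure_subset(1)[OF assms], of x "- i"] by (simp add: tle_def)

lemma mem_tge:
  assumes "t_structure C E"
  shows "x \<in> tge C E i \<longleftrightarrow> x \<in> Obj C \<and> shift_obj C i x \<in> coaisle E"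
  using mem_shift_set[OF t_structure_subset(2)[OF assms], of x "- i"] by (simp add: tge_def)

lemma tle_0: "t_structure C E \<Longrightarrow> tle C E 0 = aisle E"
  using mem_tle[of E _ 0] t_structure_subset(1)[of E] shift_obj_0 by (auto dest: subsetD)

lemma tge_0: "t_structure C E \<Longrightarrow> tge C E 0 = coaisle E"
  using mem_tge[of E _ 0] t_structure_subset(2)[of E] shift_obj_0 by (auto dest: subsetD)

lemma shift_mem_tle:
  assumes "t_structure C E" "x \<in> Obj C"
  shows "shift_obj C j x \<in> tle C E i \<longleftrightarrow> x \<in> tle C E (i + j)"
  using assms by (simp add: mem_tle shift_obj_add shift_obj_in)

lemma shift_mem_tge:
  assumes "t_structure C E" "x \<in> Obj C"
  shows "shift_obj C j x \<in> tge C E i \<longleftrightarrow> x \<in> tge C E (i + j)"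
  using assms by (simp add: mem_tge shift_obj_add shift_obj_in)

lemma tle_Obj: "t_structure C E \<Longrightarrow> x \<in> tle C E i \<Longrightarrow> x \<in> Obj C"
  by (simp add: mem_tle)

lemma tge_Obj: "t_structure C E \<Longrightarrow> x \<in> tge C E i \<Longrightarrow> x \<in> Obj C"
  by (simp add: mem_tge)

lemma tle_mono:
  assumes E: "t_structure C E" and ij: "i \<le> j" and x: "x \<in> tle C E i"
  shows "x \<in> tle C E j"
  using ij
proof (induction j rule: int_ge_induct)
  case base show ?case by (rule x)
next
  case (step j)
  have xO: "x \<in> Obj C" using tle_Obj[OF E x] .
  have "shift_obj C j x \<in> tle C E 0" using shift_mem_tle[OF E xO, of j 0] step by simp
  then have "shift_obj C j x \<in> tle C E 1" using E by (auto simp: t_structure_def)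
  then show ?case using shift_mem_tle[OF E xO, of j 1] by (simp add: add.commute)
qed

lemma tge_antimono:
  assumes E: "t_structure C E" and ij: "i \<le> j" and x: "x \<in> tge C E j"
  shows "x \<in> tge C E i"
  using ij
proof (induction i rule: int_le_induct)
  case base show ?case by (rule x)
next
  case (step i)
  have xO: "x \<in> Obj C" using tge_Obj[OF E x] .
  have "shift_obj C (i - 1) x \<in> tge C E 1" using shift_mem_tge[OF E xO, of "i - 1" 1] step by simp
  then have "shift_obj C (i - 1) x \<in> tge C E 0" using E by (auto simp: t_structure_def)
  then show ?case using shift_mem_tge[OF E xO, of "i - 1" 0] by simp
qed

lemma t_structure_hom_zero:
  assumes E: "t_structure C E" and x: "x \<in> tle C E i" and y: "y \<in> tge C E j" and ij: "i < j"
    and f: "f \<in> Hom C x y"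
  shows "f = hzero C x y"
proof -
  have xO: "x \<in> Obj C" and yO: "y \<in> Obj C" using f Hom_objects by blast+
  have "shift_obj C i x \<in> tle C E 0" using shift_mem_tle[OF E xO, of i 0] x by simp
  moreover have "shift_obj C i y \<in> tge C E 1"
    using shift_mem_tge[OF E yO, of i 1] tge_antimono[OF E _ y, of "1 + i"] ij by simp
  ultimately have "shift_arr C i f = hzero C (shift_obj C i x) (shift_obj C i y)"
    using E shift_hom[OF f, of i] unfolding t_structure_def by blast
  then show ?thesis using shift_zero_iff[OF f] by blast
qed

text \<open>One truncation triangle \<open>\<tau>\<^sup>\<le>\<^sup>0 x \<rightarrow> x \<rightarrow> \<tau>\<^sup>\<ge>\<^sup>1 x\<close> is chosen for each object. The choices
  assemble to functors because the factorisations that define them on arrows are unique.\<close>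

definition trunc_incl :: "'o t_pair \<Rightarrow> 'o \<Rightarrow> 'm" where
  "trunc_incl E x = (SOME f. \<exists>g h. (f, g, h) \<in> triangles C \<and>
     Dom C f \<in> tle C E 0 \<and> Cod C f = x \<and> Cod C g \<in> tge C E 1)"

definition trunc_proj :: "'o t_pair \<Rightarrow> 'o \<Rightarrow> 'm" where
  "trunc_proj E x = (SOME g. \<exists>h. (trunc_incl E x, g, h) \<in> triangles C \<and> Cod C g \<in> tge C E 1)"

definition trunc_le :: "'o t_pair \<Rightarrow> ('o, 'm, 'o, 'm) cat_functor" where
  "trunc_le E = \<lparr>omap = \<lambda>x. Dom C (trunc_incl E x),
     amap = \<lambda>f. THE a. a \<in> Hom C (Dom C (trunc_incl E (Dom C f))) (Dom C (trunc_incl E (Cod C f))) \<and>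
       trunc_incl E (Cod C f) \<cdot> a = f \<cdot> trunc_incl E (Dom C f)\<rparr>"

definition trunc_gt :: "'o t_pair \<Rightarrow> ('o, 'm, 'o, 'm) cat_functor" where
  "trunc_gt E = \<lparr>omap = \<lambda>x. Cod C (trunc_proj E x),
     amap = \<lambda>f. THE b. b \<in> Hom C (Cod C (trunc_proj E (Dom C f))) (Cod C (trunc_proj E (Cod C f))) \<and>
       b \<cdot> trunc_proj E (Dom C f) = trunc_proj E (Cod C f) \<cdot> f\<rparr>"

lemma truncation_triangle:
  assumes E: "t_structure C E" and x: "x \<in> Obj C"
  obtains h where "(trunc_incl E x, trunc_proj E x, h) \<in> triangles C"
    "Dom C (trunc_incl E x) = omap (trunc_le E) x" "omap (trunc_le E) x \<in> tle C E 0"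
    "Cod C (trunc_proj E x) = omap (trunc_gt E) x" "omap (trunc_gt E) x \<in> tge C E 1"
    "trunc_incl E x \<in> Hom C (omap (trunc_le E) x) x"
    "trunc_proj E x \<in> Hom C x (omap (trunc_gt E) x)"
    "h \<in> Hom C (omap (trunc_gt E) x) (shift_obj C 1 (omap (trunc_le E) x))"
proof -
  have "\<exists>f g h. (f, g, h) \<in> triangles C \<and> Dom C f \<in> tle C E 0 \<and> Cod C f = x \<and> Cod C g \<in> tge C E 1"
    using E x unfolding t_structure_def by blast
  then have 1: "\<exists>g h. (trunc_incl E x, g, h) \<in> triangles C \<and>
      Dom C (trunc_incl E x) \<in> tle C E 0 \<and> Cod C (trunc_incl E x) = x \<and> Cod C g \<in> tge C E 1"
    unfolding trunc_incl_def by (rule someI_ex)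
  then have "\<exists>g h. (trunc_incl E x, g, h) \<in> triangles C \<and> Cod C g \<in> tge C E 1" by blast
  then have "\<exists>h. (trunc_incl E x, trunc_proj E x, h) \<in> triangles C \<and> Cod C (trunc_proj E x) \<in> tge C E 1"
    unfolding trunc_proj_def by (rule someI_ex)
  then obtain h where h: "(trunc_incl E x, trunc_proj E x, h) \<in> triangles C"
    "Cod C (trunc_proj E x) \<in> tge C E 1" by blast
  show thesis
    by (rule that[OF h(1)]) (use 1 h triangle_homs[OF h(1)] in \<open>auto simp: trunc_le_def trunc_gt_def\<close>)
qed

text \<open>\<open>\<tau>\<^sup>\<le>\<^sup>0 x \<rightarrow> x\<close> is the universal map from the aisle: a map \<open>a \<rightarrow> x\<close> from the aisle composes to
  zero into \<open>\<tau>\<^sup>\<ge>\<^sup>1 x\<close>, hence factors, and two factorisations differ by a map that comes from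
  \<open>a[1] \<rightarrow> \<tau>\<^sup>\<ge>\<^sup>1 x\<close>, where \<open>a[1]\<close> is again in the aisle.\<close>

lemma trunc_incl_universal:
  assumes E: "t_structure C E" and a: "a \<in> tle C E 0" and u: "u \<in> Hom C a x"
  shows "\<exists>!v. v \<in> Hom C a (omap (trunc_le E) x) \<and> trunc_incl E x \<cdot> v = u"
proof -
  have xO: "x \<in> Obj C" and aO: "a \<in> Obj C" using u Hom_objects by blast+
  obtain h where h: "(trunc_incl E x, trunc_proj E x, h) \<in> triangles C"
    "Dom C (trunc_incl E x) = omap (trunc_le E) x"
    "Cod C (trunc_proj E x) = omap (trunc_gt E) x" "omap (trunc_gt E) x \<in> tge C E 1"
    "trunc_incl E x \<in> Hom C (omap (trunc_le E) x) x"
    "trunc_proj E x \<in> Hom C x (omap (trunc_gt E) x)"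
    using truncation_triangle[OF E xO] by metis
  have cod: "Cod C (trunc_incl E x) = x" using Hom_D[OF h(5)] by simp
  have "trunc_proj E x \<cdot> u = hzero C a (omap (trunc_gt E) x)"
    using t_structure_hom_zero[OF E a h(4) _ comp_hom[OF u h(6)]] by simp
  then have ex: "\<exists>v \<in> Hom C a (omap (trunc_le E) x). trunc_incl E x \<cdot> v = u"
    using triangle_weak_kernel[OF h(1), of u a] u h(2,3) cod by simp
  have "shift_obj C 1 a \<in> tle C E 0"
    using shift_mem_tle[OF E aO, of 1 0] tle_mono[OF E _ a, of 1] by simp
  then have "e = hzero C (shift_obj C 1 a) (omap (trunc_gt E) x)"
    if "e \<in> Hom C (shift_obj C 1 a) (omap (trunc_gt E) x)" for e
    using t_structure_hom_zero[OF E _ h(4) _ that] by simp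
  then have "v = v'" if "v \<in> Hom C a (omap (trunc_le E) x)" "v' \<in> Hom C a (omap (trunc_le E) x)"
    "trunc_incl E x \<cdot> v = trunc_incl E x \<cdot> v'" for v v'
    using triangle_first_cancel[OF h(1), of a v v'] that h(2,3) by simp
  then show ?thesis using ex by metis
qed

lemma trunc_proj_universal:
  assumes E: "t_structure C E" and b: "b \<in> tge C E 1" and u: "u \<in> Hom C x b"
  shows "\<exists>!v. v \<in> Hom C (omap (trunc_gt E) x) b \<and> v \<cdot> trunc_proj E x = u"
proof -
  have xO: "x \<in> Obj C" using u Hom_objects by blast
  obtain h where h: "(trunc_incl E x, trunc_proj E x, h) \<in> triangles C"
    "Dom C (trunc_incl E x) = omap (trunc_le E) x"
    "Cod C (trunc_proj E x) = omap (trunc_gt E) x" "omap (trunc_le E) x \<in> tle C E 0"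
    "trunc_incl E x \<in> Hom C (omap (trunc_le E) x) x"
    "trunc_proj E x \<in> Hom C x (omap (trunc_gt E) x)"
    using truncation_triangle[OF E xO] by metis
  have cod: "Cod C (trunc_incl E x) = x" using Hom_D[OF h(5)] by simp
  have "u \<cdot> trunc_incl E x = hzero C (omap (trunc_le E) x) b"
    using t_structure_hom_zero[OF E h(4) b _ comp_hom[OF h(5) u]] by simp
  then have ex: "\<exists>v \<in> Hom C (omap (trunc_gt E) x) b. v \<cdot> trunc_proj E x = u"
    using triangle_weak_cokernel[OF h(1), of u b] u h(2,3) cod by simp
  have "shift_obj C 1 (omap (trunc_le E) x) \<in> tle C E 0"
    using shift_mem_tle[OF E tle_Obj[OF E h(4)], of 1 0] tle_mono[OF E _ h(4), of 1] by simp
  then have "e = hzero C (shift_obj C 1 (omap (trunc_le E) x)) b"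
    if "e \<in> Hom C (shift_obj C 1 (omap (trunc_le E) x)) b" for e
    using t_structure_hom_zero[OF E _ b _ that] by simp
  then have "v = v'" if "v \<in> Hom C (omap (trunc_gt E) x) b" "v' \<in> Hom C (omap (trunc_gt E) x) b"
    "v \<cdot> trunc_proj E x = v' \<cdot> trunc_proj E x" for v v'
    using triangle_second_cancel[OF h(1), of b v v'] that h(2,3) by simp
  then show ?thesis using ex by metis
qed

lemma trunc_objects:
  assumes E: "t_structure C E" and x: "x \<in> Obj C"
  shows "omap (trunc_le E) x \<in> tle C E 0" "omap (trunc_gt E) x \<in> tge C E 1"
    "trunc_incl E x \<in> Hom C (omap (trunc_le E) x) x"
    "trunc_proj E x \<in> Hom C x (omap (trunc_gt E) x)"
  using truncation_triangle[OF E x] by metis+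

lemma trunc_le_arr:
  assumes E: "t_structure C E" and f: "f \<in> Hom C x y"
  shows "amap (trunc_le E) f \<in> Hom C (omap (trunc_le E) x) (omap (trunc_le E) y)"
    "trunc_incl E y \<cdot> amap (trunc_le E) f = f \<cdot> trunc_incl E x"
proof -
  have xO: "x \<in> Obj C" using f Hom_objects by blast
  note X = trunc_objects[OF E xO]
  have "amap (trunc_le E) f = (THE a. a \<in> Hom C (omap (trunc_le E) x) (omap (trunc_le E) y) \<and>
       trunc_incl E y \<cdot> a = f \<cdot> trunc_incl E x)"
    using Hom_D[OF f] by (simp add: trunc_le_def)
  then show "amap (trunc_le E) f \<in> Hom C (omap (trunc_le E) x) (omap (trunc_le E) y)"
    "trunc_incl E y \<cdot> amap (trunc_le E) f = f \<cdot> trunc_incl E x"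
    using theI'[OF trunc_incl_universal[OF E X(1) comp_hom[OF X(3) f]]] by simp_all
qed

lemma trunc_gt_arr:
  assumes E: "t_structure C E" and f: "f \<in> Hom C x y"
  shows "amap (trunc_gt E) f \<in> Hom C (omap (trunc_gt E) x) (omap (trunc_gt E) y)"
    "amap (trunc_gt E) f \<cdot> trunc_proj E x = trunc_proj E y \<cdot> f"
proof -
  have yO: "y \<in> Obj C" using f Hom_objects by blast
  note Y = trunc_objects[OF E yO]
  have "amap (trunc_gt E) f = (THE b. b \<in> Hom C (omap (trunc_gt E) x) (omap (trunc_gt E) y) \<and>
       b \<cdot> trunc_proj E x = trunc_proj E y \<cdot> f)"
    using Hom_D[OF f] by (simp add: trunc_gt_def)
  then show "amap (trunc_gt E) f \<in> Hom C (omap (trunc_gt E) x) (omap (trunc_gt E) y)"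
    "amap (trunc_gt E) f \<cdot> trunc_proj E x = trunc_proj E y \<cdot> f"
    using theI'[OF trunc_proj_universal[OF E Y(2) comp_hom[OF f Y(4)]]] by simp_all
qed

lemma trunc_le_functor:
  assumes E: "t_structure C E"
  shows "is_functor C C (trunc_le E)"
  unfolding is_functor_def
proof (intro conjI ballI allI)
  fix x assume x: "x \<in> Obj C"
  note X = trunc_objects[OF E x]
  show "omap (trunc_le E) x \<in> Obj C" using tle_Obj[OF E X(1)] .
  then show "amap (trunc_le E) (Ident C x) = Ident C (omap (trunc_le E) x)"
    using trunc_incl_universal[OF E X(1) X(3)] trunc_le_arr[OF E ident_hom[OF x]]
      ident_hom comp_ident_left[OF X(3)] comp_ident_right[OF X(3)] by metis
next
  fix x y f assume "f \<in> Hom C x y"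
  then show "amap (trunc_le E) f \<in> Hom C (omap (trunc_le E) x) (omap (trunc_le E) y)"
    using trunc_le_arr E by blast
next
  fix x y z f g assume f: "f \<in> Hom C x y" and g: "g \<in> Hom C y z"
  have O: "x \<in> Obj C" "y \<in> Obj C" "z \<in> Obj C" using f g Hom_objects by blast+
  note X = trunc_objects[OF E O(1)] and Y = trunc_objects[OF E O(2)]
    and Z = trunc_objects[OF E O(3)]
  note F = trunc_le_arr[OF E f] and G = trunc_le_arr[OF E g]
    and FG = trunc_le_arr[OF E comp_hom[OF f g]]
  have "trunc_incl E z \<cdot> (amap (trunc_le E) g \<cdot> amap (trunc_le E) f)
      = (g \<cdot> f) \<cdot> trunc_incl E x"
    using comp_assoc[OF F(1) G(1) Z(3)] comp_assoc[OF F(1) Y(3) g] comp_assoc[OF X(3) f g] F(2) G(2)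
    by simp
  then show "amap (trunc_le E) (g \<cdot> f) = amap (trunc_le E) g \<cdot> amap (trunc_le E) f"
    using trunc_incl_universal[OF E X(1) comp_hom[OF X(3) comp_hom[OF f g]]] FG
      comp_hom[OF F(1) G(1)] by metis
qed

lemma trunc_gt_functor:
  assumes E: "t_structure C E"
  shows "is_functor C C (trunc_gt E)"
  unfolding is_functor_def
proof (intro conjI ballI allI)
  fix x assume x: "x \<in> Obj C"
  note X = trunc_objects[OF E x]
  show "omap (trunc_gt E) x \<in> Obj C" using tge_Obj[OF E X(2)] .
  then show "amap (trunc_gt E) (Ident C x) = Ident C (omap (trunc_gt E) x)"
    using trunc_proj_universal[OF E X(2) X(4)] trunc_gt_arr[OF E ident_hom[OF x]]
      ident_hom comp_ident_left[OF X(4)] comp_ident_right[OF X(4)] by metis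
next
  fix x y f assume "f \<in> Hom C x y"
  then show "amap (trunc_gt E) f \<in> Hom C (omap (trunc_gt E) x) (omap (trunc_gt E) y)"
    using trunc_gt_arr E by blast
next
  fix x y z f g assume f: "f \<in> Hom C x y" and g: "g \<in> Hom C y z"
  have O: "x \<in> Obj C" "y \<in> Obj C" "z \<in> Obj C" using f g Hom_objects by blast+
  note X = trunc_objects[OF E O(1)] and Y = trunc_objects[OF E O(2)]
    and Z = trunc_objects[OF E O(3)]
  note F = trunc_gt_arr[OF E f] and G = trunc_gt_arr[OF E g]
    and FG = trunc_gt_arr[OF E comp_hom[OF f g]]
  have "(amap (trunc_gt E) g \<cdot> amap (trunc_gt E) f) \<cdot> trunc_proj E x
      = trunc_proj E z \<cdot> (g \<cdot> f)"
    using comp_assoc[OF X(4) F(1) G(1)] comp_assoc[OF f Y(4) G(1)] comp_assoc[OF f g Z(4)] F(2) G(2)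
    by simp
  then show "amap (trunc_gt E) (g \<cdot> f) = amap (trunc_gt E) g \<cdot> amap (trunc_gt E) f"
    using trunc_proj_universal[OF E Z(2) comp_hom[OF comp_hom[OF f g] Z(4)]] FG
      comp_hom[OF F(1) G(1)] by metis
qed


section \<open>Aisle and co-aisle determine each other\<close>

lemma strictly_full_iso:
  "\<lbrakk>strictly_full_additive C S; x \<in> S; isomorphic C x y\<rbrakk> \<Longrightarrow> y \<in> S"
  unfolding strictly_full_additive_def by blast

lemma tge_iso:
  assumes E: "t_structure C E" and x: "x \<in> tge C E i" and iso: "isomorphic C x y"
  shows "y \<in> tge C E i"
proof -
  have "y \<in> Obj C" using iso Hom_objects unfolding isomorphic_def by blast
  then show ?thesis
    using x strictly_full_iso[OF _ _ shift_isomorphic[OF iso, of i]] E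
    by (auto simp: mem_tge[OF E] t_structure_def)
qed

text \<open>If \<open>x\<close> has only zero maps to \<open>E\<^sup>\<ge>\<^sup>1\<close>, then \<open>x \<rightarrow> \<tau>\<^sup>\<ge>\<^sup>1 x\<close> vanishes, so the identity of \<open>x\<close>
  factors through \<open>\<tau>\<^sup>\<le>\<^sup>0 x\<close>; by uniqueness of factorisations this splitting is an isomorphism.\<close>

lemma mem_aisle_if_orthogonal:
  assumes E: "t_structure C E" and x: "x \<in> Obj C"
    and orth: "\<And>y u. \<lbrakk>y \<in> tge C E 1; u \<in> Hom C x y\<rbrakk> \<Longrightarrow> u = hzero C x y"
  shows "x \<in> tle C E 0"
proof -
  obtain h where h: "(trunc_incl E x, trunc_proj E x, h) \<in> triangles C"
    "Dom C (trunc_incl E x) = omap (trunc_le E) x" "omap (trunc_le E) x \<in> tle C E 0"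
    "Cod C (trunc_proj E x) = omap (trunc_gt E) x" "omap (trunc_gt E) x \<in> tge C E 1"
    "trunc_incl E x \<in> Hom C (omap (trunc_le E) x) x"
    "trunc_proj E x \<in> Hom C x (omap (trunc_gt E) x)"
    using truncation_triangle[OF E x] by metis
  have cod: "Cod C (trunc_incl E x) = x" using Hom_D[OF h(6)] by simp
  have "trunc_proj E x \<cdot> Ident C x = hzero C x (omap (trunc_gt E) x)"
    using orth[OF h(5) h(7)] comp_ident_right[OF h(7)] by simp
  then obtain s where s: "s \<in> Hom C x (omap (trunc_le E) x)" "trunc_incl E x \<cdot> s = Ident C x"
    using triangle_weak_kernel[OF h(1), of "Ident C x" x] ident_hom[OF x] h(2,4) cod by auto
  have lO: "omap (trunc_le E) x \<in> Obj C" using tle_Obj[OF E h(3)] .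
  have "trunc_incl E x \<cdot> (s \<cdot> trunc_incl E x) = trunc_incl E x"
    using comp_assoc[OF h(6) s(1) h(6)] s(2) comp_ident_left[OF h(6)] by simp
  then have "s \<cdot> trunc_incl E x = Ident C (omap (trunc_le E) x)"
    using trunc_incl_universal[OF E h(3) h(6)] comp_hom[OF h(6) s(1)] ident_hom[OF lO]
      comp_ident_right[OF h(6)] by metis
  then have "isomorphic C (omap (trunc_le E) x) x"
    using isomorphicI[OF h(6) s(1)] s(2) by blast
  then show ?thesis
    using h(3) strictly_full_iso E tle_0[OF E] unfolding t_structure_def by blast
qed

lemma mem_coaisle_if_orthogonal:
  assumes E: "t_structure C E" and x: "x \<in> Obj C"
    and orth: "\<And>y u. \<lbrakk>y \<in> tle C E 0; u \<in> Hom C y x\<rbrakk> \<Longrightarrow> u = hzero C y x"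
  shows "x \<in> tge C E 1"
proof -
  obtain h where h: "(trunc_incl E x, trunc_proj E x, h) \<in> triangles C"
    "Dom C (trunc_incl E x) = omap (trunc_le E) x" "omap (trunc_le E) x \<in> tle C E 0"
    "Cod C (trunc_proj E x) = omap (trunc_gt E) x" "omap (trunc_gt E) x \<in> tge C E 1"
    "trunc_incl E x \<in> Hom C (omap (trunc_le E) x) x"
    "trunc_proj E x \<in> Hom C x (omap (trunc_gt E) x)"
    using truncation_triangle[OF E x] by metis
  have cod: "Cod C (trunc_incl E x) = x" using Hom_D[OF h(6)] by simp
  have "Ident C x \<cdot> trunc_incl E x = hzero C (omap (trunc_le E) x) x"
    using orth[OF h(3) h(6)] comp_ident_left[OF h(6)] by simp
  then obtain s where s: "s \<in> Hom C (omap (trunc_gt E) x) x" "s \<cdot> trunc_proj E x = Ident C x"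
    using triangle_weak_cokernel[OF h(1), of "Ident C x" x] ident_hom[OF x] h(2,4) cod by auto
  have gO: "omap (trunc_gt E) x \<in> Obj C" using tge_Obj[OF E h(5)] .
  have "(trunc_proj E x \<cdot> s) \<cdot> trunc_proj E x = trunc_proj E x"
    using comp_assoc[OF h(7) s(1) h(7)] s(2) comp_ident_right[OF h(7)] by simp
  then have "trunc_proj E x \<cdot> s = Ident C (omap (trunc_gt E) x)"
    using trunc_proj_universal[OF E h(5) h(7)] comp_hom[OF s(1) h(7)] ident_hom[OF gO]
      comp_ident_left[OF h(7)] by metis
  then have "isomorphic C (omap (trunc_gt E) x) x"
    using isomorphicI[OF s(1) h(7)] s(2) by blast
  then show ?thesis using tge_iso[OF E h(5)] by blast
qed

lemma mem_tge_0_if_orthogonal: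
  assumes E: "t_structure C E" and x: "x \<in> Obj C"
    and orth: "\<And>y u. \<lbrakk>y \<in> tle C E (- 1); u \<in> Hom C y x\<rbrakk> \<Longrightarrow> u = hzero C y x"
  shows "x \<in> tge C E 0"
proof -
  have "shift_obj C (- 1) x \<in> tge C E 1"
  proof (rule mem_coaisle_if_orthogonal[OF E shift_obj_in[OF x]])
    fix y u assume y: "y \<in> tle C E 0" and u: "u \<in> Hom C y (shift_obj C (- 1) x)"
    have yO: "y \<in> Obj C" using tle_Obj[OF E y] .
    have "shift_obj C 1 y \<in> tle C E (- 1)" using shift_mem_tle[OF E yO, of 1 "- 1"] y by simp
    moreover have "shift_arr C 1 u \<in> Hom C (shift_obj C 1 y) x"
      using shift_hom[OF u, of 1] shift_obj_cancel(2)[OF x, of 1] by simp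
    ultimately have "shift_arr C 1 u = hzero C (shift_obj C 1 y) x" using orth by blast
    then show "u = hzero C y (shift_obj C (- 1) x)"
      using shift_zero_iff[OF u, of 1] shift_obj_cancel(2)[OF x, of 1] by simp
  qed
  then show ?thesis using shift_mem_tge[OF E x, of "- 1" 1] by simp
qed

lemma tle_subset_if_tge_subset:
  assumes E: "t_structure C E" and E': "t_structure C E'" and sub: "tge C E 1 \<subseteq> tge C E' 1"
  shows "tle C E' 0 \<subseteq> tle C E 0"
proof
  fix x assume x: "x \<in> tle C E' 0"
  show "x \<in> tle C E 0"
    using mem_aisle_if_orthogonal[OF E tle_Obj[OF E' x]] t_structure_hom_zero[OF E' x] sub
    by (metis subsetD zero_less_one)
qed

lemma tge_subset_if_tle_subset:
  assumes E: "t_structure C E" and E': "t_structure C E'" and sub: "tle C E' 0 \<subseteq> tle C E 0"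
  shows "tge C E 1 \<subseteq> tge C E' 1"
proof
  fix x assume x: "x \<in> tge C E 1"
  show "x \<in> tge C E' 1"
    using mem_coaisle_if_orthogonal[OF E' tge_Obj[OF E x]] t_structure_hom_zero[OF E _ x] sub
    by (metis subsetD zero_less_one)
qed

lemma t_structure_determined_by_coaisle:
  assumes E: "t_structure C E" and E': "t_structure C E'" and eq: "coaisle E = coaisle E'"
  shows "E = E'"
proof -
  \<comment> \<open>\<open>E\<^sup>\<le>\<^sup>0\<close> is the left orthogonal of \<open>E\<^sup>\<ge>\<^sup>1\<close>, a shift of the co-aisle.\<close>
  have "tge C E 1 = tge C E' 1" using eq by (simp add: tge_def)
  then have "tle C E 0 = tle C E' 0"
    using tle_subset_if_tge_subset[OF E E'] tle_subset_if_tge_subset[OF E' E] by blast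
  then show ?thesis using eq tle_0[OF E] tle_0[OF E'] by (simp add: prod_eq_iff)
qed


section \<open>Tilting a heart at a neighbouring t-structure\<close>

text \<open>This is the relation between a t-structure \<open>E\<close> and its Happel-Reiten-Smalo tilt \<open>E'\<close> at a
  torsion pair of the heart; the inclusions between the aisles follow by orthogonality.\<close>

definition adjacent :: "'o t_pair \<Rightarrow> 'o t_pair \<Rightarrow> bool" where
  "adjacent E E' \<longleftrightarrow> t_structure C E \<and> t_structure C E' \<and>
     tge C E' 1 \<subseteq> tge C E 0 \<and> tge C E 0 \<subseteq> tge C E' 0"

lemma mem_heart: "t_structure C E \<Longrightarrow> x \<in> heart E \<longleftrightarrow> x \<in> tle C E 0 \<and> x \<in> tge C E 0"
  by (simp add: tle_0 tge_0 heart_def)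

lemma heart_Obj: "t_structure C E \<Longrightarrow> heart E \<subseteq> Obj C"
  using t_structure_subset(1)[of E] by (auto simp: heart_def)

lemma tge_shift_subset:
  assumes E: "t_structure C E" and E': "t_structure C E'" and sub: "tge C E i \<subseteq> tge C E' j"
  shows "tge C E (i + k) \<subseteq> tge C E' (j + k)"
  using shift_mem_tge[OF E, of _ k i] shift_mem_tge[OF E', of _ k j] tge_Obj[OF E] sub by blast

lemma adjacent_tle:
  assumes "adjacent E E'"
  shows "tle C E' 0 \<subseteq> tle C E 0" "tle C E 0 \<subseteq> tle C E' 1"
proof -
  have E: "t_structure C E" and E': "t_structure C E'"
    and 1: "tge C E' 1 \<subseteq> tge C E 0" and 2: "tge C E 0 \<subseteq> tge C E' 0"
    using assms by (auto simp: adjacent_def)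
  show "tle C E' 0 \<subseteq> tle C E 0"
    using tle_subset_if_tge_subset[OF E E'] tge_shift_subset[OF E E' 2, of 1] by simp
  have 3: "tge C E' 2 \<subseteq> tge C E 1" using tge_shift_subset[OF E' E 1, of 1] by simp
  show "tle C E 0 \<subseteq> tle C E' 1"
  proof
    fix x assume x: "x \<in> tle C E 0"
    have xO: "x \<in> Obj C" using tle_Obj[OF E x] .
    have "shift_obj C 1 x \<in> tle C E' 0"
    proof (rule mem_aisle_if_orthogonal[OF E' shift_obj_in[OF xO]])
      fix y u assume y: "y \<in> tge C E' 1" and u: "u \<in> Hom C (shift_obj C 1 x) y"
      have "y \<in> tge C E 0" using y 1 by blast
      moreover have "shift_obj C 1 x \<in> tle C E (- 1)" using shift_mem_tle[OF E xO, of 1 "- 1"] x by simp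
      ultimately show "u = hzero C (shift_obj C 1 x) y" using t_structure_hom_zero[OF E _ _ _ u] by simp
    qed
    then show "x \<in> tle C E' 1" using shift_mem_tle[OF E' xO, of 1 0] by simp
  qed
qed

text \<open>Both outer terms of the truncation triangle of \<open>x\<close> stay in the heart: the sub-object is
  an extension of \<open>x\<close> by \<open>(\<tau>\<^sup>\<ge>\<^sup>1 x)[-1]\<close>, and the quotient one of \<open>(\<tau>\<^sup>\<le>\<^sup>0 x)[1]\<close> by \<open>x\<close>, and
  co-aisles and aisles are closed under extensions because they are orthogonals.\<close>

lemma truncation_in_heart:
  assumes adj: "adjacent E E'" and x: "x \<in> heart E"
  shows "omap (trunc_le E') x \<in> heart E" "omap (trunc_gt E') x \<in> heart E"
proof -
  have E: "t_structure C E" and E': "t_structure C E'" and sub: "tge C E' 1 \<subseteq> tge C E 0"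
    using adj by (auto simp: adjacent_def)
  have xl: "x \<in> tle C E 0" and xg: "x \<in> tge C E 0" and xO: "x \<in> Obj C"
    using x mem_heart[OF E] tle_Obj[OF E] by auto
  let ?A = "omap (trunc_le E') x" and ?B = "omap (trunc_gt E') x"
  obtain h where h: "(trunc_incl E' x, trunc_proj E' x, h) \<in> triangles C"
    "Dom C (trunc_incl E' x) = ?A" "?A \<in> tle C E' 0"
    "Cod C (trunc_proj E' x) = ?B" "?B \<in> tge C E' 1"
    "trunc_incl E' x \<in> Hom C ?A x" "trunc_proj E' x \<in> Hom C x ?B"
    using truncation_triangle[OF E' xO] by metis
  have cod: "Cod C (trunc_incl E' x) = x" using Hom_D[OF h(6)] by simp
  have A: "?A \<in> tle C E 0" using h(3) adjacent_tle(1)[OF adj] by blast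
  have B: "?B \<in> tge C E 0" using h(5) sub by blast
  have AO: "?A \<in> Obj C" and BO: "?B \<in> Obj C" using tle_Obj[OF E A] tge_Obj[OF E B] by auto
  have "?A \<in> tge C E 0"
  proof (rule mem_tge_0_if_orthogonal[OF E AO])
    fix y u assume y: "y \<in> tle C E (- 1)" and u: "u \<in> Hom C y ?A"
    have yO: "y \<in> Obj C" using tle_Obj[OF E y] .
    have sy: "shift_obj C 1 y \<in> tle C E (- 1)"
      using shift_mem_tle[OF E yO, of 1 "- 1"] tle_mono[OF E _ y, of 0] by simp
    have "e = hzero C (shift_obj C 1 y) ?B" if "e \<in> Hom C (shift_obj C 1 y) ?B" for e
      using t_structure_hom_zero[OF E sy B _ that] by simp
    moreover have "trunc_incl E' x \<cdot> u = trunc_incl E' x \<cdot> hzero C y ?A"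
      using t_structure_hom_zero[OF E y xg _ comp_hom[OF u h(6)]] comp_hzero_right[OF h(6) yO] by simp
    ultimately show "u = hzero C y ?A"
      using triangle_first_cancel[OF h(1), of y u "hzero C y ?A"] u hzero_hom[OF yO AO] h(2,4) by simp
  qed
  then show "?A \<in> heart E" using A mem_heart[OF E] by blast
  have sA: "shift_obj C 1 ?A \<in> tle C E 0"
    using shift_mem_tle[OF E AO, of 1 0] tle_mono[OF E _ A, of 1] by simp
  have "?B \<in> tle C E 0"
  proof (rule mem_aisle_if_orthogonal[OF E BO])
    fix y u assume y: "y \<in> tge C E 1" and u: "u \<in> Hom C ?B y"
    have yO: "y \<in> Obj C" using tge_Obj[OF E y] .
    have "e = hzero C (shift_obj C 1 ?A) y" if "e \<in> Hom C (shift_obj C 1 ?A) y" for e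
      using t_structure_hom_zero[OF E sA y _ that] by simp
    moreover have "u \<cdot> trunc_proj E' x = hzero C ?B y \<cdot> trunc_proj E' x"
      using t_structure_hom_zero[OF E xl y _ comp_hom[OF h(7) u]] comp_hzero_left[OF h(7) yO] by simp
    ultimately show "u = hzero C ?B y"
      using triangle_second_cancel[OF h(1), of y u "hzero C ?B y"] u hzero_hom[OF BO yO] h(2,4) by simp
  qed
  then show "?B \<in> heart E" using B mem_heart[OF E] by blast
qed

lemma Hom_full_subcategory:
  "Hom (full_subcategory C S) x y = {f \<in> Hom C x y. x \<in> S \<and> y \<in> S}"
  by (auto simp: Hom_def full_subcategory_def)

lemma full_subcategory_simps [simp]:
  "Dom (full_subcategory C S) = Dom C" "Cod (full_subcategory C S) = Cod C"
  "Ident (full_subcategory C S) = Ident C" "Comp (full_subcategory C S) = Comp C"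
  "hzero (full_subcategory C S) = hzero C" "Obj (full_subcategory C S) = S"
  by (auto simp: full_subcategory_def)

lemma full_subcategory_arr:
  "f \<in> Hom C x y \<Longrightarrow> f \<in> Arr (full_subcategory C S) \<longleftrightarrow> x \<in> S \<and> y \<in> S"
  by (auto simp: full_subcategory_def Hom_def)

text \<open>In the full subcategory the weak universal properties of a distinguished triangle become
  strict, since \<open>Hom(a[1], b) = 0\<close> for objects \<open>a\<close> and \<open>b\<close> of a heart.\<close>

lemma triangle_in_heart_short_exact:
  assumes E: "t_structure C E" and t: "(f, g, h) \<in> triangles C"
    and x: "Dom C f \<in> heart E" and y: "Cod C f \<in> heart E" and z: "Cod C g \<in> heart E"
  shows "short_exact (full_subcategory C (heart E)) f g"
proof -
  note F = triangle_homs(1)[OF t] and G = triangle_homs(2)[OF t]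
  note arr = full_subcategory_arr[OF F] full_subcategory_arr[OF G]
  have dom: "Dom C g = Cod C f" using Hom_D[OF G] by simp
  have sh: "shift_obj C 1 w \<in> tle C E (- 1)" if "w \<in> heart E" for w
    using that mem_heart[OF E] shift_mem_tle[OF E, of w 1 "- 1"] tle_Obj[OF E, of w 0] by simp
  have van: "e = hzero C (shift_obj C 1 w) w'"
    if "w \<in> heart E" "w' \<in> heart E" "e \<in> Hom C (shift_obj C 1 w) w'" for w w' e
    using t_structure_hom_zero[OF E sh[OF that(1)] _ _ that(3), of 0] that(2) mem_heart[OF E] by simp
  have "is_kernel (full_subcategory C (heart E)) f g"
    unfolding is_kernel_def
  proof (intro conjI allI ballI impI)
    fix w u assume "u \<in> Hom (full_subcategory C (heart E)) w (Dom (full_subcategory C (heart E)) g)"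
      and "g \<cdot>\<^bsub>full_subcategory C (heart E)\<^esub> u = hzero (full_subcategory C (heart E)) w (Cod (full_subcategory C (heart E)) g)"
    then have u: "u \<in> Hom C w (Cod C f)" and w: "w \<in> heart E" and gu: "g \<cdot> u = hzero C w (Cod C g)"
      by (auto simp: Hom_full_subcategory dom)
    have "\<exists>!v. v \<in> Hom C w (Dom C f) \<and> f \<cdot> v = u"
      using triangle_weak_kernel[OF t u gu] triangle_first_cancel[OF t van[OF w z]] by metis
    then show "\<exists>!v. v \<in> Hom (full_subcategory C (heart E)) w (Dom (full_subcategory C (heart E)) f) \<and>
        f \<cdot>\<^bsub>full_subcategory C (heart E)\<^esub> v = u"
      using w x by (simp add: Hom_full_subcategory)
  qed (use arr x y z dom triangle_comp_zero[OF t] in auto)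
  moreover have "is_cokernel (full_subcategory C (heart E)) g f"
    unfolding is_cokernel_def
  proof (intro conjI allI ballI impI)
    fix w u assume "u \<in> Hom (full_subcategory C (heart E)) (Cod (full_subcategory C (heart E)) f) w"
      and "u \<cdot>\<^bsub>full_subcategory C (heart E)\<^esub> f = hzero (full_subcategory C (heart E)) (Dom (full_subcategory C (heart E)) f) w"
    then have u: "u \<in> Hom C (Cod C f) w" and w: "w \<in> heart E" and uf: "u \<cdot> f = hzero C (Dom C f) w"
      by (auto simp: Hom_full_subcategory)
    have "\<exists>!v. v \<in> Hom C (Cod C g) w \<and> v \<cdot> g = u"
      using triangle_weak_cokernel[OF t u uf] triangle_second_cancel[OF t van[OF x w]] by metis
    then show "\<exists>!v. v \<in> Hom (full_subcategory C (heart E)) (Cod (full_subcategory C (heart E)) g) w \<and>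
        v \<cdot>\<^bsub>full_subcategory C (heart E)\<^esub> g = u"
      using w z by (simp add: Hom_full_subcategory)
  qed (use arr x y z dom triangle_comp_zero[OF t] in auto)
  ultimately show ?thesis by (simp add: short_exact_def)
qed

lemma truncation_short_exact:
  assumes adj: "adjacent E E'" and x: "x \<in> heart E"
  shows "short_exact (full_subcategory C (heart E)) (trunc_incl E' x) (trunc_proj E' x)"
proof -
  have E: "t_structure C E" and E': "t_structure C E'" using adj by (auto simp: adjacent_def)
  have xO: "x \<in> Obj C" using x heart_Obj[OF E] by blast
  obtain h where h: "(trunc_incl E' x, trunc_proj E' x, h) \<in> triangles C"
    "Dom C (trunc_incl E' x) = omap (trunc_le E') x" 
    "Cod C (trunc_proj E' x) = omap (trunc_gt E') x"
    "trunc_incl E' x \<in> Hom C (omap (trunc_le E') x) x"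
    using truncation_triangle[OF E' xO] by metis
  then show ?thesis
    using triangle_in_heart_short_exact[OF E h(1)] truncation_in_heart[OF adj x] x Hom_D[OF h(4)]
    by simp
qed

text \<open>The torsion-free part lies in \<open>E\<^sup>\<le>\<^sup>0 \<subseteq> E'\<^sup>\<le>\<^sup>1\<close> and in \<open>E'\<^sup>\<ge>\<^sup>1\<close>, so it is concentrated in
  degree one for \<open>E'\<close>, whereas the torsion part stays in degree zero.\<close>

lemma torsion_in_next_heart:
  assumes adj: "adjacent E E'"
  shows "tle C E' 0 \<inter> heart E \<subseteq> heart E'"
  using adj mem_heart[of E] mem_heart[of E'] unfolding adjacent_def by blast

lemma torsion_free_in_next_heart:
  assumes adj: "adjacent E E'"
  shows "tge C E' 1 \<inter> heart E \<subseteq> shift_set C (heart E') (- 1)"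
proof
  fix x assume x: "x \<in> tge C E' 1 \<inter> heart E"
  have E: "t_structure C E" and E': "t_structure C E'" using adj by (auto simp: adjacent_def)
  have xO: "x \<in> Obj C" using x heart_Obj[OF E] by blast
  have "x \<in> tle C E' 1" using x mem_heart[OF E] adjacent_tle(2)[OF adj] by blast
  then have "shift_obj C 1 x \<in> heart E'"
    using x xO mem_heart[OF E'] shift_mem_tle[OF E' xO, of 1 0] shift_mem_tge[OF E' xO, of 1 0] by simp
  then show "x \<in> shift_set C (heart E') (- 1)"
    using mem_shift_set[OF heart_Obj[OF E'], of x "- 1"] xO by simp
qed

lemma shift_ex1:
  assumes xO: "x \<in> Obj C" and yO: "y \<in> Obj C"
    and ex1: "\<exists>!v. v \<in> Hom C x y \<and> P v"
    and PQ: "\<And>v. v \<in> Hom C x y \<Longrightarrow> P v \<longleftrightarrow> Q (shift_arr C i v)"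
  shows "\<exists>!v. v \<in> Hom C (shift_obj C i x) (shift_obj C i y) \<and> Q v"
  using ex1 PQ shift_full[of _ i x y] shift_hom[of _ x y i] xO yO by metis

text \<open>The shift is an automorphism of \<open>C\<close> carrying the full subcategory on \<open>S\<close> onto the one on
  \<open>S[i]\<close>, so kernels and cokernels are transported.\<close>

lemma shift_short_exact:
  assumes S: "S \<subseteq> Obj C" and se: "short_exact (full_subcategory C S) f g"
  shows "short_exact (full_subcategory C (shift_set C S i)) (shift_arr C i f) (shift_arr C i g)"
proof -
  let ?S = "shift_set C S i" and ?s = "shift_obj C i" and ?a = "shift_arr C i"
  have k: "is_kernel (full_subcategory C S) f g" and c: "is_cokernel (full_subcategory C S) g f"
    using se by (auto simp: short_exact_def)
  obtain x y z where f: "f \<in> Hom C x y" and g: "g \<in> Hom C y z"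
    and xS: "x \<in> S" and yS: "y \<in> S" and zS: "z \<in> S" and gf: "g \<cdot> f = hzero C x z"
    using k unfolding is_kernel_def by (auto simp: full_subcategory_def Hom_def)
  have O: "x \<in> Obj C" "y \<in> Obj C" "z \<in> Obj C" using xS yS zS S by auto
  note F = shift_hom[OF f, of i] and G = shift_hom[OF g, of i]
  note D = Hom_D[OF f] Hom_D[OF g] Hom_D[OF F] Hom_D[OF G]
  have xyz: "?s x \<in> ?S" "?s y \<in> ?S" "?s z \<in> ?S" using xS yS zS by (auto simp: shift_set_def)
  note arr = full_subcategory_arr[OF F] full_subcategory_arr[OF G]
  have GF: "?a g \<cdot> ?a f = hzero C (?s x) (?s z)"
    using shift_comp[OF f g, of i] gf shift_hzero[OF O(1,3), of i] by simp
  have ker: "\<exists>!v. v \<in> Hom C w x \<and> f \<cdot> v = u"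
    if "u \<in> Hom C w y" "w \<in> S" "g \<cdot> u = hzero C w z" for w u
    using k that xS yS D unfolding is_kernel_def by (auto simp: Hom_full_subcategory)
  have coker: "\<exists>!v. v \<in> Hom C z w \<and> v \<cdot> g = u"
    if "u \<in> Hom C y w" "w \<in> S" "u \<cdot> f = hzero C x w" for w u
    using c that yS zS D unfolding is_cokernel_def by (auto simp: Hom_full_subcategory)
  have ker': "\<exists>!v. v \<in> Hom C w (?s x) \<and> ?a f \<cdot> v = u"
    if u: "u \<in> Hom C w (?s y)" and w: "w \<in> ?S" and gu: "?a g \<cdot> u = hzero C w (?s z)" for w u
  proof -
    obtain w' where w': "w' \<in> S" "w = ?s w'" using w by (auto simp: shift_set_def)
    then have w'O: "w' \<in> Obj C" using S by blast
    obtain u' where u': "u' \<in> Hom C w' y" "?a u' = u" using shift_full[of u i w' y] u w' w'O O by blast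
    have "g \<cdot> u' = hzero C w' z"
      using gu u' w' shift_comp[OF u'(1) g, of i] shift_zero_iff[OF comp_hom[OF u'(1) g], of i] by simp
    from ker[OF u'(1) w'(1) this] show ?thesis
      unfolding w'(2)
    proof (rule shift_ex1[OF w'O O(1)])
      fix v assume v: "v \<in> Hom C w' x"
      show "f \<cdot> v = u' \<longleftrightarrow> ?a f \<cdot> ?a v = u"
        using shift_comp[OF v f, of i] u' shift_faithful[OF comp_hom[OF v f] u'(1), of i] by auto
    qed
  qed
  have coker': "\<exists>!v. v \<in> Hom C (?s z) w \<and> v \<cdot> ?a g = u"
    if u: "u \<in> Hom C (?s y) w" and w: "w \<in> ?S" and uf: "u \<cdot> ?a f = hzero C (?s x) w" for w u
  proof -
    obtain w' where w': "w' \<in> S" "w = ?s w'" using w by (auto simp: shift_set_def)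
    then have w'O: "w' \<in> Obj C" using S by blast
    obtain u' where u': "u' \<in> Hom C y w'" "?a u' = u" using shift_full[of u i y w'] u w' w'O O by blast
    have "u' \<cdot> f = hzero C x w'"
      using uf u' w' shift_comp[OF f u'(1), of i] shift_zero_iff[OF comp_hom[OF f u'(1)], of i] by simp
    from coker[OF u'(1) w'(1) this] show ?thesis
      unfolding w'(2)
    proof (rule shift_ex1[OF O(3) w'O])
      fix v assume v: "v \<in> Hom C z w'"
      show "v \<cdot> g = u' \<longleftrightarrow> ?a v \<cdot> ?a g = u"
        using shift_comp[OF g v, of i] u' shift_faithful[OF comp_hom[OF g v] u'(1), of i] by auto
    qed
  qed
  have "is_kernel (full_subcategory C ?S) (?a f) (?a g)"
    unfolding is_kernel_def using arr D xyz GF ker' by (auto simp: Hom_full_subcategory)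
  moreover have "is_cokernel (full_subcategory C ?S) (?a g) (?a f)"
    unfolding is_cokernel_def using arr D xyz GF coker' by (auto simp: Hom_full_subcategory)
  ultimately show ?thesis by (simp add: short_exact_def)
qed


section \<open>The tree of a sequence of adjacent t-structures\<close>

definition id_functor :: "('o, 'm, 'o, 'm) cat_functor" where
  "id_functor = \<lparr>omap = \<lambda>x. x, amap = \<lambda>f. f\<rparr>"

definition functor_comp ::
  "('o, 'm, 'o, 'm) cat_functor \<Rightarrow> ('o, 'm, 'o, 'm) cat_functor \<Rightarrow> ('o, 'm, 'o, 'm) cat_functor" where
  "functor_comp G F = \<lparr>omap = \<lambda>x. omap G (omap F x), amap = \<lambda>f. amap G (amap F f)\<rparr>"

lemma functor_comp_is_functor:
  "\<lbrakk>is_functor A C F; is_functor C C G\<rbrakk> \<Longrightarrow> is_functor A C (functor_comp G F)"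
  unfolding is_functor_def functor_comp_def by simp metis

lemma shift_is_functor: "is_functor C C (shift C i)"
  using shift_functor by (simp add: additive_functor_def)

lemma id_functor_on_full_subcategory:
  "S \<subseteq> Obj C \<Longrightarrow> is_functor (full_subcategory C S) C id_functor"
  unfolding is_functor_def id_functor_def by (auto simp: Hom_full_subcategory)

text \<open>An object \<open>x\<close> in \<open>\<H>[-s]\<close> is shifted by \<open>s\<close> into the heart \<open>\<H>\<close>, truncated there, and shifted back.\<close>

definition child_functor ::
  "'o t_pair \<Rightarrow> int \<Rightarrow> nat \<Rightarrow> ('o, 'm, 'o, 'm) cat_functor \<Rightarrow> ('o, 'm, 'o, 'm) cat_functor" where
  "child_functor E s i F = functor_comp (shift C (- s))
     (functor_comp (if i = 0 then trunc_le E else trunc_gt E) (functor_comp (shift C s) F))"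

definition child_incl :: "'o t_pair \<Rightarrow> int \<Rightarrow> ('o, 'm, 'o, 'm) cat_functor \<Rightarrow> 'o \<Rightarrow> 'm" where
  "child_incl E s F X = shift_arr C (- s) (trunc_incl E (shift_obj C s (omap F X)))"

definition child_proj :: "'o t_pair \<Rightarrow> int \<Rightarrow> ('o, 'm, 'o, 'm) cat_functor \<Rightarrow> 'o \<Rightarrow> 'm" where
  "child_proj E s F X = shift_arr C (- s) (trunc_proj E (shift_obj C s (omap F X)))"

lemma child_functor_is_functor:
  assumes E: "t_structure C E" and F: "is_functor A C F"
  shows "is_functor A C (child_functor E s i F)"
  unfolding child_functor_def
  using trunc_le_functor[OF E] trunc_gt_functor[OF E]
  by (intro functor_comp_is_functor shift_is_functor F) auto

lemma child_functor_omap: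
  "omap (child_functor E s 0 F) X = shift_obj C (- s) (omap (trunc_le E) (shift_obj C s (omap F X)))"
  "omap (child_functor E s 1 F) X = shift_obj C (- s) (omap (trunc_gt E) (shift_obj C s (omap F X)))"
  by (simp_all add: child_functor_def functor_comp_def)

lemma child_functor_amap:
  "amap (child_functor E s 0 F) f = shift_arr C (- s) (amap (trunc_le E) (shift_arr C s (amap F f)))"
  "amap (child_functor E s 1 F) f = shift_arr C (- s) (amap (trunc_gt E) (shift_arr C s (amap F f)))"
  by (simp_all add: child_functor_def functor_comp_def)

lemma child_incl_natural:
  assumes E: "t_structure C E" and F: "is_functor A C F"
  shows "natural_transformation A C (child_functor E s 0 F) F (child_incl E s F)"
  unfolding natural_transformation_def child_functor_omap child_functor_amap child_incl_def
proof (intro conjI ballI allI)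
  fix X assume "X \<in> Obj A"
  then have O: "omap F X \<in> Obj C" using F by (simp add: is_functor_def)
  show "shift_arr C (- s) (trunc_incl E (shift_obj C s (omap F X)))
      \<in> Hom C (shift_obj C (- s) (omap (trunc_le E) (shift_obj C s (omap F X)))) (omap F X)"
    using shift_hom[OF trunc_objects(3)[OF E shift_obj_in[OF O, of s]], of "- s"]
      shift_obj_cancel(1)[OF O, of s] by simp
next
  fix X Y f assume f: "f \<in> Hom A X Y"
  then have Ff: "amap F f \<in> Hom C (omap F X) (omap F Y)" using F by (simp add: is_functor_def)
  then have O: "omap F X \<in> Obj C" "omap F Y \<in> Obj C" using Hom_objects by blast+
  note \<phi> = shift_hom[OF Ff, of s]
  note t = trunc_le_arr[OF E \<phi>]
  note i = trunc_objects(3)[OF E shift_obj_in[OF O(1), of s]]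
    and j = trunc_objects(3)[OF E shift_obj_in[OF O(2), of s]]
  show "shift_arr C (- s) (trunc_incl E (shift_obj C s (omap F Y)))
        \<cdot> shift_arr C (- s) (amap (trunc_le E) (shift_arr C s (amap F f)))
      = amap F f \<cdot> shift_arr C (- s) (trunc_incl E (shift_obj C s (omap F X)))"
    using shift_comp[OF t(1) j, of "- s"] shift_comp[OF i \<phi>, of "- s"] t(2)
      shift_arr_cancel(1) Hom_D[OF Ff] by simp
qed

lemma child_proj_natural:
  assumes E: "t_structure C E" and F: "is_functor A C F"
  shows "natural_transformation A C F (child_functor E s 1 F) (child_proj E s F)"
  unfolding natural_transformation_def child_functor_omap child_functor_amap child_proj_def
proof (intro conjI ballI allI)
  fix X assume "X \<in> Obj A"
  then have O: "omap F X \<in> Obj C" using F by (simp add: is_functor_def)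
  show "shift_arr C (- s) (trunc_proj E (shift_obj C s (omap F X)))
      \<in> Hom C (omap F X) (shift_obj C (- s) (omap (trunc_gt E) (shift_obj C s (omap F X))))"
    using shift_hom[OF trunc_objects(4)[OF E shift_obj_in[OF O, of s]], of "- s"]
      shift_obj_cancel(1)[OF O, of s] by simp
next
  fix X Y f assume f: "f \<in> Hom A X Y"
  then have Ff: "amap F f \<in> Hom C (omap F X) (omap F Y)" using F by (simp add: is_functor_def)
  then have O: "omap F X \<in> Obj C" "omap F Y \<in> Obj C" using Hom_objects by blast+
  note \<phi> = shift_hom[OF Ff, of s]
  note t = trunc_gt_arr[OF E \<phi>]
  note i = trunc_objects(4)[OF E shift_obj_in[OF O(1), of s]]
    and j = trunc_objects(4)[OF E shift_obj_in[OF O(2), of s]]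
  show "shift_arr C (- s) (trunc_proj E (shift_obj C s (omap F Y))) \<cdot> amap F f
      = shift_arr C (- s) (amap (trunc_gt E) (shift_arr C s (amap F f)))
        \<cdot> shift_arr C (- s) (trunc_proj E (shift_obj C s (omap F X)))"
    using shift_comp[OF i t(1), of "- s"] shift_comp[OF \<phi> j, of "- s"] t(2)
      shift_arr_cancel(1) Hom_D[OF Ff] by simp
qed

text \<open>Children append a letter to a word, so the recursion runs over the reversed word.\<close>

primrec rev_vertex_functor :: "(nat \<Rightarrow> 'o t_pair) \<Rightarrow> nat list \<Rightarrow> ('o, 'm, 'o, 'm) cat_functor" where
  "rev_vertex_functor E [] = id_functor"
| "rev_vertex_functor E (i # v) =
     child_functor (E (Suc (length v))) (int (sum_list v)) i (rev_vertex_functor E v)"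

definition vertex_functor :: "(nat \<Rightarrow> 'o t_pair) \<Rightarrow> nat list \<Rightarrow> ('o, 'm, 'o, 'm) cat_functor" where
  "vertex_functor E w = rev_vertex_functor E (rev w)"

lemma vertex_functor_Nil: "vertex_functor E [] = id_functor"
  by (simp add: vertex_functor_def)

lemma vertex_functor_snoc:
  "vertex_functor E (w @ [i]) = child_functor (E (Suc (length w))) (int (sum_list w)) i (vertex_functor E w)"
  by (simp add: vertex_functor_def sum_list_rev)

lemma vertex_functor_is_functor:
  assumes adj: "\<And>l. adjacent (E l) (E (Suc l))"
  shows "is_functor (full_subcategory C (heart (E 0))) C (vertex_functor E w)"
proof -
  have E: "t_structure C (E l)" for l using adj[of l] by (simp add: adjacent_def)
  show ?thesis
    by (induction w rule: rev_induct)
      (simp_all add: vertex_functor_Nil vertex_functor_snoc id_functor_on_full_subcategory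
        heart_Obj[OF E] child_functor_is_functor[OF E])
qed

text \<open>Each torsion part lies in the next heart, each torsion-free part in the next heart shifted
  by \<open>-1\<close>; the letters of the word add up these shifts.\<close>

lemma vertex_in_shifted_heart:
  assumes adj: "\<And>l. adjacent (E l) (E (Suc l))" and w: "w \<in> binary_words" and X: "X \<in> heart (E 0)"
  shows "shift_obj C (int (sum_list w)) (omap (vertex_functor E w) X) \<in> heart (E (length w))"
  using w
proof (induction w rule: rev_induct)
  case Nil
  have "t_structure C (E 0)" using adj[of 0] by (simp add: adjacent_def)
  then have "X \<in> Obj C" using X heart_Obj by blast
  then show ?case using X by (simp add: vertex_functor_Nil id_functor_def shift_obj_0)
next
  case (snoc i w)
  let ?s = "int (sum_list w)" and ?l = "length w"
  let ?y = "shift_obj C ?s (omap (vertex_functor E w) X)"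
  have E: "t_structure C (E l)" for l using adj[of l] by (simp add: adjacent_def)
  have y: "?y \<in> heart (E ?l)" using snoc by (simp add: binary_words_def)
  then have yO: "?y \<in> Obj C" using heart_Obj[OF E] by blast
  note t = trunc_objects[OF E yO, of "Suc ?l"] and h = truncation_in_heart[OF adj y]
  have i: "i = 0 \<or> i = 1" using snoc.prems by (auto simp: binary_words_def)
  then show ?case
  proof
    assume i: "i = 0"
    have "omap (trunc_le (E (Suc ?l))) ?y \<in> heart (E (Suc ?l))"
      using torsion_in_next_heart[OF adj[of ?l]] t(1) h(1) by blast
    then show ?thesis
      using i shift_obj_cancel(2)[OF tle_Obj[OF E t(1)], of ?s]
      by (simp add: vertex_functor_snoc child_functor_omap)
  next
    assume i: "i = 1"
    let ?B = "omap (trunc_gt (E (Suc ?l))) ?y"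
    have BO: "?B \<in> Obj C" using tge_Obj[OF E t(2)] .
    have "?B \<in> shift_set C (heart (E (Suc ?l))) (- 1)"
      using torsion_free_in_next_heart[OF adj[of ?l]] t(2) h(2) by blast
    then have "shift_obj C 1 ?B \<in> heart (E (Suc ?l))"
      using mem_shift_set[OF heart_Obj[OF E]] by simp
    moreover have "shift_obj C (int (sum_list (w @ [i]))) (shift_obj C (- ?s) ?B) = shift_obj C 1 ?B"
      using i BO by (simp add: shift_obj_add)
    ultimately show ?thesis
      using i by (simp add: vertex_functor_snoc child_functor_omap(2)[unfolded One_nat_def])
  qed
qed

lemma vertex_short_exact:
  assumes adj: "\<And>l. adjacent (E l) (E (Suc l))" and w: "w \<in> binary_words" and X: "X \<in> heart (E 0)"
  defines "l \<equiv> length w" and "s \<equiv> int (sum_list w)"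
  shows "short_exact (full_subcategory C (shift_set C (heart (E l)) (- s)))
      (child_incl (E (Suc l)) s (vertex_functor E w) X) (child_proj (E (Suc l)) s (vertex_functor E w) X)"
    "omap (vertex_functor E (w @ [0])) X \<in> shift_set C (tle C (E (Suc l)) 0 \<inter> heart (E l)) (- s)"
    "omap (vertex_functor E (w @ [1])) X \<in> shift_set C (tge C (E (Suc l)) 1 \<inter> heart (E l)) (- s)"
proof -
  let ?y = "shift_obj C s (omap (vertex_functor E w) X)"
  have E: "t_structure C (E l)" for l using adj[of l] by (simp add: adjacent_def)
  have y: "?y \<in> heart (E l)" using vertex_in_shifted_heart[OF adj w X] by (simp add: l_def s_def)
  then have yO: "?y \<in> Obj C" using heart_Obj[OF E] by blast
  note t = trunc_objects[OF E yO, of "Suc l"] and h = truncation_in_heart[OF adj y]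
  show "short_exact (full_subcategory C (shift_set C (heart (E l)) (- s)))
      (child_incl (E (Suc l)) s (vertex_functor E w) X) (child_proj (E (Suc l)) s (vertex_functor E w) X)"
    unfolding child_incl_def child_proj_def
    using shift_short_exact[OF heart_Obj[OF E] truncation_short_exact[OF adj y]] .
  show "omap (vertex_functor E (w @ [0])) X \<in> shift_set C (tle C (E (Suc l)) 0 \<inter> heart (E l)) (- s)"
    unfolding vertex_functor_snoc child_functor_omap shift_set_def
    using t(1) h(1) by (auto simp: l_def s_def)
  show "omap (vertex_functor E (w @ [1])) X \<in> shift_set C (tge C (E (Suc l)) 1 \<inter> heart (E l)) (- s)"
    unfolding vertex_functor_snoc child_functor_omap shift_set_def
    using t(2) h(2) by (auto simp: l_def s_def)
qed


section \<open>Right basic t-structures\<close>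

text \<open>The definite description denotes: a t-structure is determined by its co-aisle,
  and filterability provides existence.\<close>

lemma right_basic_t_structure:
  assumes rf: "right_filterable C D T"
  shows "t_structure C (right_basic C D T i)"
    "coaisle (right_basic C D T i) = tge C D (- i) \<inter> tge C T 0"
proof -
  have "\<exists>!E. t_structure C E \<and> nondegenerate C E \<and> coaisle E = tge C D (- i) \<inter> tge C T 0"
    using rf t_structure_determined_by_coaisle unfolding right_filterable_def by metis
  from theI'[OF this] show "t_structure C (right_basic C D T i)"
    "coaisle (right_basic C D T i) = tge C D (- i) \<inter> tge C T 0"
    unfolding right_basic_def by blast+
qed

lemma right_basic_tge:
  assumes D: "t_structure C D" and T: "t_structure C T" and rf: "right_filterable C D T"
  shows "tge C (right_basic C D T i) j = tge C D (j - i) \<inter> tge C T j"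
  using mem_tge[OF right_basic_t_structure(1)[OF rf]] right_basic_t_structure(2)[OF rf, of i]
    shift_mem_tge[OF D, of _ j "- i"] shift_mem_tge[OF T, of _ j 0] tge_Obj[OF D]
  by (auto simp: add.commute)

lemma right_basic_adjacent:
  assumes D: "t_structure C D" and T: "t_structure C T" and rf: "right_filterable C D T"
  shows "adjacent (right_basic C D T i) (right_basic C D T (i + 1))"
  using right_basic_t_structure(1)[OF rf] right_basic_tge[OF D T rf]
    tge_antimono[OF T, of 0 1] tge_antimono[OF D, of "- i - 1" "- i"]
  by (auto simp: adjacent_def)

lemma right_basic_0:
  assumes D: "t_structure C D" and T: "t_structure C T" and rf: "right_filterable C D T"
    and sub: "tle C T 0 \<subseteq> tle C D 0"
  shows "right_basic C D T 0 = D"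
proof (rule t_structure_determined_by_coaisle[OF right_basic_t_structure(1)[OF rf] D])
  have "tge C D 0 \<subseteq> tge C T 0"
    using tge_shift_subset[OF D T tge_subset_if_tle_subset[OF D T sub], of "- 1"] by simp
  then show "coaisle (right_basic C D T 0) = coaisle D"
    using right_basic_t_structure(2)[OF rf, of 0] tge_0[OF D] by auto
qed

end


section \<open>The right t-tree\<close>

theorem theorem3p1:
  fixes C :: "('o, 'm) triangulated_category"
    and D T :: "'o t_pair"
    and n :: nat
  assumes "triangulated_category C"
    and "t_structure C D" and "nondegenerate C D"
    and "t_structure C T" and "nondegenerate C T"
    and "right_filterable C D T"
    and "of_type C D T n 0"
  shows "\<exists>F \<iota> \<pi>. functorial_right_t_tree C D T n F \<iota> \<pi>"
proof -
  interpret triangulated_category C by fact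
  define E where "E l = right_basic C D T (int l)" for l :: nat
  have E0: "E 0 = D"
    using right_basic_0 assms by (simp add: E_def of_type_def)
  have adj: "adjacent (E l) (E (Suc l))" for l
    using right_basic_adjacent[of D T "int l"] assms by (simp add: E_def add.commute)
  have E: "t_structure C (E l)" for l using adj[of l] by (simp add: adjacent_def)
  let ?F = "vertex_functor E"
  let ?\<iota> = "\<lambda>w. child_incl (E (Suc (length w))) (int (sum_list w)) (?F w)"
  let ?\<pi> = "\<lambda>w. child_proj (E (Suc (length w))) (int (sum_list w)) (?F w)"
  have F: "is_functor (full_subcategory C (heart D)) C (?F w)" for w
    using vertex_functor_is_functor[of E, OF adj] E0 by simp
  have torsion: "right_basic_torsion C D T (int l) = tle C (E (Suc l)) 0 \<inter> heart (E l)"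
    "right_basic_torsion_free C D T (int l) = tge C (E (Suc l)) 1 \<inter> heart (E l)"
    "right_basic_heart C D T (int l) = heart (E l)" for l
    by (simp_all add: right_basic_torsion_def right_basic_torsion_free_def
        right_basic_heart_def E_def add.commute)
  have "functorial_right_t_tree C D T n ?F ?\<iota> ?\<pi>"
    unfolding functorial_right_t_tree_def Let_def torsion
  proof (intro conjI ballI impI)
    fix w assume w: "w \<in> binary_words"
    show "is_functor (full_subcategory C (heart D)) C (?F w)" by (rule F)
    show "natural_transformation (full_subcategory C (heart D)) C (?F (w @ [0])) (?F w) (?\<iota> w)"
      using child_incl_natural[OF E F] by (simp add: vertex_functor_snoc)
    show "natural_transformation (full_subcategory C (heart D)) C (?F w) (?F (w @ [1])) (?\<pi> w)"
      using child_proj_natural[OF E F] by (simp add: vertex_functor_snoc)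
    fix X assume "X \<in> heart D"
    then have X: "X \<in> heart (E 0)" using E0 by simp
    note V = vertex_short_exact[of E, OF adj w X]
    show "short_exact (full_subcategory C (shift_set C (heart (E (length w))) (- int (sum_list w))))
        (?\<iota> w X) (?\<pi> w X)" by (rule V(1))
    show "omap (?F (w @ [0])) X
        \<in> shift_set C (tle C (E (Suc (length w))) 0 \<inter> heart (E (length w))) (- int (sum_list w))"
      by (rule V(2))
    show "omap (?F (w @ [1])) X
        \<in> shift_set C (tge C (E (Suc (length w))) 1 \<inter> heart (E (length w))) (- int (sum_list w))"
      by (rule V(3))
  qed (simp_all add: vertex_functor_Nil id_functor_def)
  then show ?thesis by blast
qed

end
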